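(* Let $\ell$ be a positive integer. Then there exist a positive integer $k=k(\ell)$, a constant $c=c(\ell,k)\ge 0$ and an integer $N=N(\ell,k)$ such that the following holds for every positive integer $n$. Let $\mathcal{F}\subset 2^{[n]}$ be a family of subsets of $[n]=\{1,\dots,n\}$ such that for any $k$ distinct members $F_1,\dots,F_k\in\mathcal{F}$, the size $|F_1\cap\dots\cap F_k|$ is divisible by $\ell$. Then $|\mathcal{F}|\leq 2^{\lfloor n/\ell\rfloor}+c$. Moreover, if $\ell\mid n$ and $n\ge N$, then $|\mathcal{F}|\le 2^{\lfloor n/\ell\rfloor}$. *)

theory Defs
  imports Complex_Main
begin

end

(*
  For a prime p dividing l, let A_j be the span over F_p of the indicators of intersections of at
  most j members of F.  Since all dimensions are at most n, some j = 2^i with i bounded in terms of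
  l satisfies dim A_2j <= dim A_j + eps n, simultaneously for all p.  A Kneser type theorem for
  the pointwise product then gives a space V between A_j and A_2j whose stabilizer is an algebra of
  dimension close to dim V.  The algebra is spanned by the indicators of the classes of a partition,
  and on almost all of these classes V is one-dimensional; such a class is a twin class of F
  (a class of points not separated by F) whose indicator lies in A_2j.  On the union of the remaining
  classes F has at most 2^(n/8l) traces.  So F is essentially determined by the twin classes D
  isolated for all p, and |D| is divisible by l as soon as the intersections of boundedly many
  members of F are.

  If every such D has size different from l, then all of them have at least 2l points and
  |F| <= 2^(n/2l + n/8l); twin classes of size l can be split off one by one.

  If only k distinct members are controlled, an isolated D with l not dividing |D| lies in few
  members: whenever the intersection of q members containing D is contained in k members of F, it
  can be used to pad shorter intersections to exactly k sets, which forces l to divide |D|.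
  So, once the twin classes of size l are split off, either few points remain or F is
  far below the bound; in the former case the traces with at least k preimages (the heavy ones)
  may be repeated, so that they are divisible in the strong sense, and only boundedly many light
  traces are left.
*)
theory Submission
  imports
    Defs
    "HOL-Library.FuncSet"
    "HOL-Real_Asymp.Real_Asymp"
    "HOL-Number_Theory.Cong"
begin

section \<open>A Kneser type theorem for pointwise products modulo p\<close>

text \<open>Subgroups of \<open>(\<int>/p)\<^sup>X\<close> are represented by their preimages in the group of
  all integer valued functions, and \<open>sz\<close> is the order of the subgroup of \<open>(\<int>/p)\<^sup>X\<close>.
  Orders replace dimensions, which avoids having \<open>\<int>/p\<close> as a type.\<close>

definition msub :: "int \<Rightarrow> 'a set \<Rightarrow> ('a \<Rightarrow> int) set \<Rightarrow> bool" where
  "msub p X V \<longleftrightarrow> (\<forall>f\<in>V. \<forall>g\<in>V. (\<lambda>x. f x - g x) \<in> V) \<and>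
     (\<forall>f. (\<forall>x\<in>X. [f x = 0] (mod p)) \<longrightarrow> f \<in> V)"

definition red :: "int \<Rightarrow> 'a set \<Rightarrow> ('a \<Rightarrow> int) \<Rightarrow> 'a \<Rightarrow> int" where
  "red p X f = restrict (\<lambda>x. f x mod p) X"

definition sz :: "int \<Rightarrow> 'a set \<Rightarrow> ('a \<Rightarrow> int) set \<Rightarrow> nat" where
  "sz p X V = card (red p X ` V)"

definition stab :: "('a \<Rightarrow> int) set \<Rightarrow> ('a \<Rightarrow> int) set" where
  "stab V = {h. \<forall>v\<in>V. (\<lambda>x. h x * v x) \<in> V}"

section \<open>Closure properties, reduction modulo p, and orders of subgroups\<close>

lemma msub_diff: "msub p X V \<Longrightarrow> f \<in> V \<Longrightarrow> g \<in> V \<Longrightarrow> (\<lambda>x. f x - g x) \<in> V"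
  by (auto simp: msub_def)

lemma msub_null: "msub p X V \<Longrightarrow> (\<And>x. x \<in> X \<Longrightarrow> [f x = 0] (mod p)) \<Longrightarrow> f \<in> V"
  by (auto simp: msub_def)

lemma msub_zero: "msub p X V \<Longrightarrow> (\<lambda>x. 0) \<in> V"
  by (rule msub_null) auto

lemma msub_add:
  assumes "msub p X V" "f \<in> V" "g \<in> V"
  shows "(\<lambda>x. f x + g x) \<in> V"
  using msub_diff[OF assms(1,2) msub_diff[OF assms(1) msub_zero[OF assms(1)] assms(3)]] by simp

lemma msub_cong:
  assumes V: "msub p X V" and f: "f \<in> V" and fg: "\<And>x. x \<in> X \<Longrightarrow> [g x = f x] (mod p)"
  shows "g \<in> V"
proof -
  have "(\<lambda>x. g x - f x) \<in> V"
    by (rule msub_null[OF V]) (use fg in \<open>simp add: cong_iff_dvd_diff\<close>)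
  from msub_add[OF V this f] show ?thesis by simp
qed

text \<open>Integer multiples are repeated sums, so a subgroup of functions modulo p is
  automatically a subspace.\<close>

lemma msub_scale:
  assumes V: "msub p X V" and f: "f \<in> V"
  shows "(\<lambda>x. c * f x) \<in> V"
proof (induction c rule: int_induct[of _ 0])
  case base
  then show ?case using msub_zero[OF V] by simp
next
  case (step1 i)
  then show ?case using msub_add[OF V step1(2) f] by (simp add: algebra_simps)
next
  case (step2 i)
  then show ?case using msub_diff[OF V step2(2) f] by (simp add: algebra_simps)
qed

lemma msub_sum:
  assumes V: "msub p X V" and f: "\<And>i. i \<in> I \<Longrightarrow> f i \<in> V"
  shows "(\<lambda>x. \<Sum>i\<in>I. f i x) \<in> V"
  using f
proof (induction I rule: infinite_finite_induct)
  case (insert i I)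
  have "(\<lambda>x. f i x + (\<Sum>i\<in>I. f i x)) \<in> V"
    by (rule msub_add[OF V]) (use insert in auto)
  then show ?case using insert by simp
qed (use msub_zero[OF V] in auto)

lemma red_eq_iff: "red p X f = red p X g \<longleftrightarrow> (\<forall>x\<in>X. [f x = g x] (mod p))"
  by (auto simp: red_def restrict_def cong_def fun_eq_iff)

lemma red_cong: "x \<in> X \<Longrightarrow> [red p X f x = f x] (mod p)"
  by (simp add: red_def cong_def)

lemma red_mem_iff:
  assumes "msub p X V"
  shows "red p X f \<in> V \<longleftrightarrow> f \<in> V"
  using msub_cong[OF assms] red_cong by (metis cong_sym)

lemma red_image_mem_iff:
  assumes "msub p X V"
  shows "red p X f \<in> red p X ` V \<longleftrightarrow> f \<in> V"
  using msub_cong[OF assms] by (auto simp: red_eq_iff)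

lemma finite_red:
  assumes "finite X" "p > 0"
  shows "finite (red p X ` V)"
proof (rule finite_subset)
  show "red p X ` V \<subseteq> X \<rightarrow>\<^sub>E {0..<p}" using assms by (auto simp: red_def)
  show "finite (X \<rightarrow>\<^sub>E {0..<p})" using assms by (intro finite_PiE) auto
qed

lemma sz_mono:
  assumes "finite X" "p > 0" "V \<subseteq> W"
  shows "sz p X V \<le> sz p X W"
  unfolding sz_def by (intro card_mono finite_red assms image_mono)

lemma sz_le:
  assumes "finite X" "p > 0"
  shows "sz p X V \<le> nat p ^ card X"
proof -
  have "card (red p X ` V) \<le> card (X \<rightarrow>\<^sub>E {0..<p})"
    by (rule card_mono) (use assms in \<open>auto simp: red_def intro!: finite_PiE\<close>)
  then show ?thesis using assms by (simp add: sz_def card_PiE)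
qed

lemma sz_pos:
  assumes "finite X" "p > 0" "V \<noteq> {}"
  shows "sz p X V > 0"
  unfolding sz_def using assms finite_red[OF assms(1,2)] by (simp add: card_gt_0_iff)

section \<open>The Dyson transform and the Kneser type theorem\<close>

lemma card_le_image_fibres:
  assumes "finite A" and "\<And>a. a \<in> A \<Longrightarrow> card {b \<in> A. f b = f a} \<le> k"
  shows "card A \<le> card (f ` A) * k"
proof -
  have "A = (\<Union>u\<in>f ` A. {b \<in> A. f b = u})" by auto
  then have "card A \<le> (\<Sum>u\<in>f ` A. card {b \<in> A. f b = u})"
    using card_UN_le[of "f ` A" "\<lambda>u. {b \<in> A. f b = u}"] assms(1) by simp
  also have "\<dots> \<le> (\<Sum>u\<in>f ` A. k)" by (rule sum_mono) (use assms in auto)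
  finally show ?thesis by simp
qed

text \<open>Map \<open>(s, t)\<close> to \<open>t + s * e\<close>, whose values form the enlarged
  group. Two pairs with the same value satisfy \<open>(s - s0) * e = t0 - t\<close> modulo p, and
  the right side is in \<open>T\<close>; hence a fibre is no larger than the group of those
  \<open>s\<close> with \<open>s * e\<close> in \<open>T\<close>.\<close>

lemma dyson_transform_size:
  assumes X: "finite X" "p > 0" and S: "msub p X S" and T: "msub p X T"
  shows "sz p X S * sz p X T \<le>
    sz p X {s \<in> S. (\<lambda>x. s x * e x) \<in> T} * sz p X {f. \<exists>t\<in>T. \<exists>s\<in>S. f = (\<lambda>x. t x + s x * e x)}"
    (is "_ \<le> sz p X ?S' * sz p X ?T'")
proof -
  let ?A = "red p X ` S \<times> red p X ` T"
  define \<phi> where "\<phi> = (\<lambda>(s, t). red p X (\<lambda>x. t x + s x * e x))"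
  have "card ?A \<le> card (\<phi> ` ?A) * sz p X ?S'"
  proof (rule card_le_image_fibres)
    show "finite ?A" using finite_red[OF X] by auto
    fix a assume a: "a \<in> ?A"
    obtain s0 t0 where a_eq: "a = (s0, t0)" by (cases a)
    have s0: "s0 \<in> S" and t0: "t0 \<in> T" using a a_eq red_mem_iff[OF S] red_mem_iff[OF T] by auto
    \<comment> \<open>Within a fibre \<open>s - s0\<close> determines \<open>s\<close>, and then
      \<open>t\<close>, modulo p.\<close>
    define \<psi> where "\<psi> = (\<lambda>(s, t :: 'a \<Rightarrow> int). red p X (\<lambda>x. s x - s0 x))"
    have fib: "s \<in> S \<and> t \<in> T \<and> red p X s = s \<and> red p X t = t \<and>
        (\<forall>x\<in>X. [t x + s x * e x = t0 x + s0 x * e x] (mod p))"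
      if "(s, t) \<in> {b \<in> ?A. \<phi> b = \<phi> a}" for s t
      using that red_mem_iff[OF S] red_mem_iff[OF T]
      by (auto simp: \<phi>_def a_eq red_eq_iff) (auto simp: red_def restrict_def)
    have "card {b \<in> ?A. \<phi> b = \<phi> a} \<le> card (red p X ` ?S')"
    proof (rule card_inj_on_le)
      show "finite (red p X ` ?S')" by (rule finite_red[OF X])
      show "\<psi> ` {b \<in> ?A. \<phi> b = \<phi> a} \<subseteq> red p X ` ?S'"
      proof
        fix u assume "u \<in> \<psi> ` {b \<in> ?A. \<phi> b = \<phi> a}"
        then obtain s t where st: "(s, t) \<in> {b \<in> ?A. \<phi> b = \<phi> a}" and u: "u = red p X (\<lambda>x. s x - s0 x)"
          by (auto simp: \<psi>_def)
        note f = fib[OF st]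
        have "(\<lambda>x. s x - s0 x) \<in> S" using f s0 msub_diff[OF S] by blast
        moreover have "(\<lambda>x. (s x - s0 x) * e x) \<in> T"
        proof (rule msub_cong[OF T])
          show "(\<lambda>x. t0 x - t x) \<in> T" using f t0 msub_diff[OF T] by blast
          show "[(s x - s0 x) * e x = t0 x - t x] (mod p)" if "x \<in> X" for x
            using f that by (auto simp: cong_iff_dvd_diff algebra_simps)
        qed
        ultimately show "u \<in> red p X ` ?S'" unfolding u by blast
      qed
      show "inj_on \<psi> {b \<in> ?A. \<phi> b = \<phi> a}"
      proof (rule inj_onI)
        fix b b' assume b: "b \<in> {b \<in> ?A. \<phi> b = \<phi> a}" and b': "b' \<in> {b \<in> ?A. \<phi> b = \<phi> a}" and eq: "\<psi> b = \<psi> b'"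
        obtain s t s' t' where st: "b = (s, t)" "b' = (s', t')" by (cases b, cases b')
        note f = fib[OF b[unfolded st]] fib[OF b'[unfolded st]]
        have ss: "\<forall>x\<in>X. [s x = s' x] (mod p)"
          using eq by (auto simp: st \<psi>_def red_eq_iff cong_iff_dvd_diff)
        have "[t x = t' x] (mod p)" if "x \<in> X" for x
        proof -
          have "[t x + s x * e x = t' x + s' x * e x] (mod p)"
            using f that by (meson cong_sym cong_trans)
          moreover have "[s x * e x = s' x * e x] (mod p)" using ss that by (auto intro: cong_scalar_right)
          ultimately show ?thesis using cong_diff by fastforce
        qed
        then have "red p X t = red p X t'" "red p X s = red p X s'" using ss by (auto simp: red_eq_iff)
        then show "b = b'" using f st by simp
      qed
    qed
    then show "card {b \<in> ?A. \<phi> b = \<phi> a} \<le> sz p X ?S'" by (simp add: sz_def)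
  qed
  also have "card (\<phi> ` ?A) \<le> sz p X ?T'"
    unfolding sz_def
  proof (rule card_mono)
    show "finite (red p X ` ?T')" by (rule finite_red[OF X])
    show "\<phi> ` ?A \<subseteq> red p X ` ?T'"
    proof clarify
      fix s t assume "s \<in> S" "t \<in> T"
      then have "red p X s \<in> S" "red p X t \<in> T" using red_mem_iff[OF S] red_mem_iff[OF T] by auto
      then show "\<phi> (red p X s, red p X t) \<in> red p X ` ?T'"
        unfolding \<phi>_def by (auto intro!: imageI)
    qed
  qed
  finally show ?thesis by (simp add: sz_def card_cartesian_product mult.commute)
qed

text \<open>Diderrich's argument: if some \<open>e \<in> T\<close> does not satisfy \<open>S e \<subseteq> T\<close>, the transform
  replaces \<open>S\<close> by the smaller group \<open>S'\<close> without changing the product of the orders or leaving \<open>U\<close>;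
  otherwise \<open>S\<close> stabilizes \<open>T\<close>.\<close>

lemma kneser:
  assumes X: "finite X" "p > 0" and U: "msub p X U"
    and S: "msub p X S" and T: "msub p X T" and one: "(\<lambda>x. 1) \<in> S"
    and ST: "\<And>s t. s \<in> S \<Longrightarrow> t \<in> T \<Longrightarrow> (\<lambda>x. s x * t x) \<in> U"
  shows "\<exists>V. msub p X V \<and> T \<subseteq> V \<and> V \<subseteq> U \<and> sz p X S * sz p X T \<le> sz p X V * sz p X (stab V)"
  using S T one ST
proof (induction "sz p X S" arbitrary: S T rule: less_induct)
  case less
  note S = less.prems(1) and T = less.prems(2) and one = less.prems(3) and ST = less.prems(4)
  show ?case
  proof (cases "\<forall>s\<in>S. \<forall>e\<in>T. (\<lambda>x. s x * e x) \<in> T")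
    case True
    have "T \<subseteq> U" using ST[OF one] by auto
    moreover have "S \<subseteq> stab T" using True by (auto simp: stab_def)
    then have "sz p X S \<le> sz p X (stab T)" by (rule sz_mono[OF X])
    ultimately show ?thesis using T by (intro exI[of _ T]) (auto simp: mult.commute intro: mult_right_mono)
  next
    case False
    then obtain s1 e where s1: "s1 \<in> S" and e: "e \<in> T" and s1e: "(\<lambda>x. s1 x * e x) \<notin> T" by auto
    define S' where "S' = {s \<in> S. (\<lambda>x. s x * e x) \<in> T}"
    define T' where "T' = {f. \<exists>t\<in>T. \<exists>s\<in>S. f = (\<lambda>x. t x + s x * e x)}"
    have S': "msub p X S'"
      unfolding msub_def
    proof (intro conjI ballI allI impI)
      fix f g assume "f \<in> S'" "g \<in> S'"
      then show "(\<lambda>x. f x - g x) \<in> S'"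
        using msub_diff[OF S] msub_diff[OF T, of "\<lambda>x. f x * e x" "\<lambda>x. g x * e x"]
        by (auto simp: S'_def left_diff_distrib)
    next
      fix f assume f: "\<forall>x\<in>X. [f x = 0] (mod p)"
      have "f \<in> S" using msub_null[OF S] f by blast
      moreover have "(\<lambda>x. f x * e x) \<in> T"
        by (rule msub_null[OF T]) (use f in \<open>auto simp: cong_0_iff\<close>)
      ultimately show "f \<in> S'" by (simp add: S'_def)
    qed
    have T': "msub p X T'"
      unfolding msub_def
    proof (intro conjI ballI allI impI)
      fix f g assume "f \<in> T'" "g \<in> T'"
      then obtain t s t' s' where "t \<in> T" "s \<in> S" "t' \<in> T" "s' \<in> S"
        "f = (\<lambda>x. t x + s x * e x)" "g = (\<lambda>x. t' x + s' x * e x)" by (auto simp: T'_def)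
      then show "(\<lambda>x. f x - g x) \<in> T'"
        unfolding T'_def using msub_diff[OF S, of s s'] msub_diff[OF T, of t t']
        by (intro CollectI bexI[of _ "\<lambda>x. t x - t' x"] bexI[of _ "\<lambda>x. s x - s' x"])
           (auto simp: algebra_simps)
    next
      fix f assume "\<forall>x\<in>X. [f x = 0] (mod p)"
      then have "f \<in> T" using msub_null[OF T] by blast
      then show "f \<in> T'" unfolding T'_def using msub_zero[OF S]
        by (intro CollectI bexI[of _ f] bexI[of _ "\<lambda>x. 0"]) auto
    qed
    have "S' \<subseteq> S" by (auto simp: S'_def)
    have "red p X s1 \<notin> red p X ` S'"
      using red_image_mem_iff[OF S'] s1e by (auto simp: S'_def)
    then have "red p X ` S' \<subset> red p X ` S" using s1 \<open>S' \<subseteq> S\<close> by blast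
    then have lt: "sz p X S' < sz p X S" unfolding sz_def by (rule psubset_card_mono[OF finite_red[OF X]])
    have one': "(\<lambda>x. 1) \<in> S'" using one e by (simp add: S'_def)
    have prods: "(\<lambda>x. s x * t x) \<in> U" if s: "s \<in> S'" and t: "t \<in> T'" for s t
    proof -
      obtain t1 s2 where ts: "t1 \<in> T" "s2 \<in> S" "t = (\<lambda>x. t1 x + s2 x * e x)"
        using t unfolding T'_def by blast
      have "(\<lambda>x. s x * t1 x) \<in> U" "(\<lambda>x. s2 x * (s x * e x)) \<in> U" using s ts ST by (auto simp: S'_def)
      from msub_add[OF U this] show ?thesis by (simp add: ts algebra_simps)
    qed
    from less.hyps[OF lt S' T' one' prods]
    obtain V where V: "msub p X V" "T' \<subseteq> V" "V \<subseteq> U"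
      and le: "sz p X S' * sz p X T' \<le> sz p X V * sz p X (stab V)" by auto
    have "T \<subseteq> T'"
    proof
      fix t assume "t \<in> T"
      then show "t \<in> T'"
        unfolding T'_def using msub_zero[OF S]
        by (intro CollectI bexI[of _ t] bexI[of _ "\<lambda>x. 0"]) auto
    qed
    moreover have "sz p X S * sz p X T \<le> sz p X S' * sz p X T'"
      unfolding S'_def T'_def by (rule dyson_transform_size[OF X S T])
    ultimately show ?thesis using V le by (intro exI[of _ V]) auto
  qed
qed

section \<open>Isolated classes modulo a prime\<close>

definition ind :: "'a set \<Rightarrow> 'a \<Rightarrow> int" where
  "ind A x = of_bool (x \<in> A)"

text \<open>The dual functions vanish on \<open>Y\<close>, so adding combinations of them to
  \<open>ind A\<close> leaves the trace of \<open>A\<close> on \<open>Y\<close> readable; once the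
  trace is known, the values on \<open>Q\<close> reveal the coefficients. With \<open>Y\<close>
  empty this is a dimension count; with \<open>Y\<close> the union of the bad classes it also counts
  traces.\<close>

lemma sz_ge_dual_system:
  assumes X: "finite X" "p > 1" and V: "msub p X V" and Q: "Q \<subseteq> X" and Y: "Y \<subseteq> X"
    and dual: "\<And>q. q \<in> Q \<Longrightarrow> \<exists>v\<in>V. [v q = 1] (mod p) \<and> (\<forall>z\<in>Q \<union> Y - {q}. [v z = 0] (mod p))"
    and disj: "Q \<inter> Y = {}" and T: "\<And>A. A \<in> T \<Longrightarrow> ind A \<in> V"
  shows "card ((\<lambda>A. A \<inter> Y) ` T) * nat p ^ card Q \<le> sz p X V"
proof -
  obtain v where v: "\<And>q. q \<in> Q \<Longrightarrow> v q \<in> V" "\<And>q. q \<in> Q \<Longrightarrow> [v q q = 1] (mod p)"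
    "\<And>q z. q \<in> Q \<Longrightarrow> z \<in> Q \<union> Y - {q} \<Longrightarrow> [v q z = 0] (mod p)"
  proof -
    obtain v where "\<forall>q\<in>Q. v q \<in> V \<and> [v q q = 1] (mod p) \<and> (\<forall>z\<in>Q \<union> Y - {q}. [v q z = 0] (mod p))"
      using bchoice[of Q "\<lambda>q v. v \<in> V \<and> [v q = 1] (mod p) \<and> (\<forall>z\<in>Q \<union> Y - {q}. [v z = 0] (mod p))"] dual
      by (auto simp: Bex_def)
    then show thesis using that by blast
  qed
  let ?R = "(\<lambda>A. A \<inter> Y) ` T"
  obtain A where A: "\<And>t. t \<in> ?R \<Longrightarrow> A t \<in> T" "\<And>t. t \<in> ?R \<Longrightarrow> A t \<inter> Y = t"
  proof -
    have "\<forall>t\<in>?R. \<exists>A. A \<in> T \<and> A \<inter> Y = t" by auto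
    from bchoice[OF this] show thesis using that by auto
  qed
  have finQ: "finite Q" using Q X finite_subset by blast
  \<comment> \<open>One fixed set \<open>A t\<close> represents each trace \<open>t\<close>;
    otherwise the values on \<open>Q\<close> would depend on more than
    \<open>(t, c)\<close>.\<close>
  define \<psi> where "\<psi> = (\<lambda>(t, c). red p X (\<lambda>x. ind (A t) x + (\<Sum>q\<in>Q. c q * v q x)))"
  have val: "[(\<Sum>q\<in>Q. c q * v q z) = (if z \<in> Q then c z else 0)] (mod p)" if "z \<in> Q \<union> Y" for c z
  proof -
    have "[(\<Sum>q\<in>Q. c q * v q z) = (\<Sum>q\<in>Q. if q = z then c z else 0)] (mod p)"
    proof (rule cong_sum)
      fix q assume "q \<in> Q"
      show "[c q * v q z = (if q = z then c z else 0)] (mod p)"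
      proof (cases "q = z")
        case True
        then show ?thesis using cong_scalar_left[OF v(2)[OF \<open>q \<in> Q\<close>], of "c q"] by simp
      next
        case False
        then have "[v q z = 0] (mod p)" using v(3)[OF \<open>q \<in> Q\<close>] that by auto
        from cong_scalar_left[OF this, of "c q"] show ?thesis using False by simp
      qed
    qed
    then show ?thesis using finQ by simp
  qed
  have "card (?R \<times> (Q \<rightarrow>\<^sub>E {0..<p})) \<le> card (red p X ` V)"
  proof (rule card_inj_on_le)
    show "finite (red p X ` V)" by (rule finite_red) (use X in auto)
    show "\<psi> ` (?R \<times> (Q \<rightarrow>\<^sub>E {0..<p})) \<subseteq> red p X ` V"
    proof clarify
      fix B c assume "B \<in> T"
      then have "ind (A (B \<inter> Y)) \<in> V" using A T by blast
      moreover have "(\<lambda>x. \<Sum>q\<in>Q. c q * v q x) \<in> V"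
        by (intro msub_sum[OF V] msub_scale[OF V] v(1))
      ultimately show "\<psi> (B \<inter> Y, c) \<in> red p X ` V"
        unfolding \<psi>_def using msub_add[OF V] by auto
    qed
    show "inj_on \<psi> (?R \<times> (Q \<rightarrow>\<^sub>E {0..<p}))"
    proof (rule inj_onI)
      fix a a' assume a: "a \<in> ?R \<times> (Q \<rightarrow>\<^sub>E {0..<p})" "a' \<in> ?R \<times> (Q \<rightarrow>\<^sub>E {0..<p})" and eq: "\<psi> a = \<psi> a'"
      obtain t c t' c' where tc: "a = (t, c)" "a' = (t', c')" by (cases a, cases a')
      have t: "t \<in> ?R" "t' \<in> ?R" and c: "c \<in> Q \<rightarrow>\<^sub>E {0..<p}" "c' \<in> Q \<rightarrow>\<^sub>E {0..<p}" using a tc by auto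
      have eq': "[ind (A t) z + (\<Sum>q\<in>Q. c q * v q z) = ind (A t') z + (\<Sum>q\<in>Q. c' q * v q z)] (mod p)"
        if "z \<in> X" for z
        using eq that by (auto simp: tc \<psi>_def red_eq_iff)
      have eq'': "[ind (A t) z + (if z \<in> Q then c z else 0) = ind (A t') z + (if z \<in> Q then c' z else 0)] (mod p)"
        if "z \<in> Q \<union> Y" for z
      proof -
        have z: "z \<in> X" using that Q Y by blast
        show ?thesis
          by (rule cong_trans[OF cong_add[OF cong_refl cong_sym[OF val[OF that]]]
                cong_trans[OF eq'[OF z] cong_add[OF cong_refl val[OF that]]]])
      qed
      have "z \<in> t \<longleftrightarrow> z \<in> t'" if "z \<in> Y" for z
      proof -
        have "z \<notin> Q" using that disj by auto
        then have "[ind (A t) z = ind (A t') z] (mod p)" using eq''[of z] that by auto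
        then have "z \<in> A t \<longleftrightarrow> z \<in> A t'" using X(2) by (auto simp: ind_def cong_def)
        then show ?thesis using A(2) t that by blast
      qed
      moreover have "t \<subseteq> Y" "t' \<subseteq> Y" using t by auto
      ultimately have tt: "t = t'" by blast
      have "c z = c' z" if "z \<in> Q" for z
      proof -
        have "[c z = c' z] (mod p)" using eq''[of z] that tt by (auto simp: cong_add_lcancel)
        moreover have "c z \<in> {0..<p}" "c' z \<in> {0..<p}" using c that by auto
        ultimately show ?thesis by (simp add: cong_def)
      qed
      then have "c = c'" using c by (intro PiE_ext[of c Q _ c'])
      then show "a = a'" by (simp add: tc tt)
    qed
  qed
  then show ?thesis using finQ by (simp add: sz_def card_cartesian_product card_PiE)
qed

text \<open>\<open>W\<close> and \<open>U\<close> stand for the spans of intersections of at most j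
  and at most 2j members. The theorem above yields \<open>V\<close> between them with stabilizer
  \<open>H\<close>. Classes on which \<open>V\<close> is large are collected in \<open>Y\<close>,
  and their number is paid for by the growth from \<open>W\<close> to \<open>U\<close>; every other
  class yields the indicator of a twin class.\<close>

lemma mod_prime_step:
  assumes fin: "finite X" and p: "prime p" and W: "msub p X W" and U: "msub p X U"
    and WU: "W \<subseteq> U" and prods: "\<And>f g. f \<in> W \<Longrightarrow> g \<in> W \<Longrightarrow> (\<lambda>x. f x * g x) \<in> U"
    and F: "\<And>A. A \<in> F \<Longrightarrow> ind A \<in> W" and cover: "\<And>x. x \<in> X \<Longrightarrow> \<exists>A\<in>F. x \<in> A"
    and const: "\<And>f x y. f \<in> U \<Longrightarrow> x \<in> X \<Longrightarrow> y \<in> X \<Longrightarrow> \<forall>A\<in>F. x \<in> A \<longleftrightarrow> y \<in> A \<Longrightarrow> [f x = f y] (mod p)"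
  shows "\<exists>Y\<subseteq>X. card ((\<lambda>A. A \<inter> Y) ` F) * sz p X W ^ 4 \<le> sz p X U ^ 4 \<and>
    (\<forall>x\<in>X - Y. \<exists>g\<in>U. \<forall>y\<in>X. [g y = of_bool (\<forall>A\<in>F. x \<in> A \<longleftrightarrow> y \<in> A)] (mod p))"
proof -
  have p1: "p > 1" using p prime_gt_1_int by blast
  then have p0: "p > 0" by simp
  \<comment> \<open>Constants are adjoined only on one side, so that \<open>S W\<close> stays inside \<open>U\<close>.\<close>
  define S where "S = {f. \<exists>w\<in>W. \<exists>c. f = (\<lambda>x. w x + c)}"
  have S: "msub p X S"
    unfolding msub_def
  proof (intro conjI ballI allI impI)
    fix f g assume "f \<in> S" "g \<in> S"
    then obtain w c w' c' where "w \<in> W" "w' \<in> W" "f = (\<lambda>x. w x + c)" "g = (\<lambda>x. w' x + c')"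
      by (auto simp: S_def)
    then show "(\<lambda>x. f x - g x) \<in> S"
      unfolding S_def using msub_diff[OF W, of w w']
      by (intro CollectI bexI[of _ "\<lambda>x. w x - w' x"] exI[of _ "c - c'"]) auto
  next
    fix f :: "'a \<Rightarrow> int" assume "\<forall>x\<in>X. [f x = 0] (mod p)"
    then have "f \<in> W" using msub_null[OF W] by blast
    then show "f \<in> S" unfolding S_def by (intro CollectI bexI[of _ f] exI[of _ 0]) auto
  qed
  have one: "(\<lambda>x. 1) \<in> S"
    unfolding S_def using msub_zero[OF W] by (intro CollectI bexI[of _ "\<lambda>x. 0"] exI[of _ 1]) auto
  have SW: "(\<lambda>x. s x * t x) \<in> U" if s: "s \<in> S" and t: "t \<in> W" for s t
  proof -
    obtain w c where "w \<in> W" "s = (\<lambda>x. w x + c)" using s by (auto simp: S_def)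
    then show ?thesis using msub_add[OF U prods[of w t] msub_scale[OF U, of t c]] t WU
      by (auto simp: distrib_right)
  qed
  have "W \<subseteq> S" unfolding S_def by (intro subsetI CollectI) (metis add.right_neutral)
  then have szS: "sz p X W \<le> sz p X S" by (rule sz_mono[OF fin p0])
  obtain V where V: "msub p X V" and WV: "W \<subseteq> V" and VU: "V \<subseteq> U"
    and le: "sz p X S * sz p X W \<le> sz p X V * sz p X (stab V)"
    using kneser[OF fin p0 U S W one SW] by auto
  define H where "H = stab V"
  have HV: "(\<lambda>x. h x * v x) \<in> V" if "h \<in> H" "v \<in> V" for h v
    using that by (auto simp: H_def stab_def)
  have H_const: "(\<lambda>x. c) \<in> H" for c
    unfolding H_def stab_def using msub_scale[OF V] by auto
  have H_diff: "(\<lambda>x. f x - g x) \<in> H" if "f \<in> H" "g \<in> H" for f g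
    using that unfolding H_def stab_def using msub_diff[OF V] by (auto simp: left_diff_distrib)
  have H_mult: "(\<lambda>x. f x * g x) \<in> H" if "f \<in> H" "g \<in> H" for f g
    using that unfolding H_def stab_def by (auto simp: mult.assoc)
  have H_prod: "(\<lambda>x. \<Prod>i\<in>I. f i x) \<in> H" if "\<And>i. i \<in> I \<Longrightarrow> f i \<in> H" for I :: "'a set" and f
    using that
  proof (induction I rule: infinite_finite_induct)
    case (insert i I)
    have "(\<lambda>x. f i x * (\<Prod>i\<in>I. f i x)) \<in> H"
      by (rule H_mult) (use insert in auto)
    then show ?case using insert by simp
  qed (use H_const[of 1] in auto)
  have H_cong: "g \<in> H" if f: "f \<in> H" and fg: "\<And>x. x \<in> X \<Longrightarrow> [g x = f x] (mod p)" for f g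
    unfolding H_def stab_def
  proof (intro CollectI ballI)
    fix v assume "v \<in> V"
    show "(\<lambda>x. g x * v x) \<in> V"
      by (rule msub_cong[OF V HV[OF f \<open>v \<in> V\<close>]]) (use fg in \<open>auto intro: cong_scalar_right\<close>)
  qed
  define cls where "cls x = {y \<in> X. \<forall>h\<in>H. [h x = h y] (mod p)}" for x
  have cls_refl: "x \<in> cls x" if "x \<in> X" for x using that by (auto simp: cls_def)
  have cls_eq: "cls y = cls x" if "y \<in> cls x" for x y
  proof -
    have "[h y = h z] (mod p) \<longleftrightarrow> [h x = h z] (mod p)" if "h \<in> H" for h z
    proof -
      have "[h x = h y] (mod p)" using \<open>y \<in> cls x\<close> \<open>h \<in> H\<close> by (simp add: cls_def)
      then show ?thesis by (simp add: cong_def)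
    qed
    then show ?thesis by (auto simp: cls_def)
  qed
  \<comment> \<open>Lagrange interpolation inside the algebra \<open>H\<close>: each point outside
    the class is separated from \<open>x\<close> by some \<open>h\<close>, which is normalised to be
    1 at \<open>x\<close> and 0 at that point. Primality of \<open>p\<close> provides the inverse;
    the product of these factors is the indicator.\<close>
  have cls_ind: "ind (cls x) \<in> H" if x: "x \<in> X" for x
  proof -
    have "\<exists>e\<in>H. [e x = 1] (mod p) \<and> [e y = 0] (mod p)" if y: "y \<in> X - cls x" for y
    proof -
      obtain h where h: "h \<in> H" "\<not> [h x = h y] (mod p)" using y by (auto simp: cls_def)
      then have "\<not> p dvd h x - h y" by (simp add: cong_iff_dvd_diff)
      then have "coprime (h x - h y) p" using p by (metis coprime_commute prime_imp_coprime)
      then obtain c where c: "[(h x - h y) * c = 1] (mod p)" using cong_solve_coprime_int by blast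
      have "(\<lambda>z. (h z - h y) * c) \<in> H" using H_mult[OF H_diff[OF h(1) H_const] H_const] .
      then show ?thesis using c by (intro bexI[of _ "\<lambda>z. (h z - h y) * c"]) auto
    qed
    then obtain e where e: "\<And>y. y \<in> X - cls x \<Longrightarrow> e y \<in> H"
      "\<And>y. y \<in> X - cls x \<Longrightarrow> [e y x = 1] (mod p)" "\<And>y. y \<in> X - cls x \<Longrightarrow> [e y y = 0] (mod p)"
      by metis
    have "(\<lambda>z. \<Prod>y\<in>X - cls x. e y z) \<in> H" by (rule H_prod) (use e in auto)
    then show ?thesis
    proof (rule H_cong)
      fix z assume z: "z \<in> X"
      show "[ind (cls x) z = (\<Prod>y\<in>X - cls x. e y z)] (mod p)"
      proof (cases "z \<in> cls x")
        case True
        have "[(\<Prod>y\<in>X - cls x. e y z) = (\<Prod>y\<in>X - cls x. 1)] (mod p)"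
        proof (rule cong_prod)
          fix y assume y: "y \<in> X - cls x"
          have "[e y x = e y z] (mod p)" using True e(1)[OF y] by (auto simp: cls_def)
          then show "[e y z = 1] (mod p)" using e(2)[OF y] cong_sym cong_trans by blast
        qed
        then show ?thesis using True by (simp add: ind_def cong_sym_eq)
      next
        case False
        have "p dvd e z z" using e(3)[of z] False z by (simp add: cong_0_iff)
        also have "e z z dvd (\<Prod>y\<in>X - cls x. e y z)"
          by (rule dvd_prodI) (use False z fin in auto)
        finally show ?thesis using False by (subst cong_sym_eq) (simp add: ind_def cong_0_iff)
      qed
    qed
  qed
  define \<C> where "\<C> = cls ` X"
  have finC: "finite \<C>" using fin by (simp add: \<C>_def)
  have C_cls: "C = cls x" if "C \<in> \<C>" "x \<in> C" for C x
    using that cls_eq by (auto simp: \<C>_def)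
  have C_sub: "C \<subseteq> X" if "C \<in> \<C>" for C using that by (auto simp: \<C>_def cls_def)
  have C_ind: "ind C \<in> H" if "C \<in> \<C>" for C using that cls_ind by (auto simp: \<C>_def)
  \<comment> \<open>A good class contributes at least one dimension to \<open>V\<close>, a bad one at least two.\<close>
  define bad where "bad C \<longleftrightarrow> (\<exists>x\<in>C. \<exists>y\<in>C. \<exists>A\<in>F. x \<in> A \<and> y \<notin> A)" for C
  have ex: "\<exists>a b A B. a \<in> C \<and> b \<in> C \<and> A \<in> F \<and> B \<in> F \<and> a \<in> A \<and> b \<in> B \<and> (bad C \<longrightarrow> b \<notin> A)"
    if C: "C \<in> \<C>" for C
  proof (cases "bad C")
    case True
    then obtain x y A where "x \<in> C" "y \<in> C" "A \<in> F" "x \<in> A" "y \<notin> A" by (auto simp: bad_def)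
    moreover obtain B where "B \<in> F" "y \<in> B" using cover C_sub[OF C] \<open>y \<in> C\<close> by blast
    ultimately show ?thesis by blast
  next
    case False
    obtain x where "x \<in> X" "C = cls x" using C by (auto simp: \<C>_def)
    then have "x \<in> C" using cls_refl by simp
    then show ?thesis using False cover[OF \<open>x \<in> X\<close>] by blast
  qed
  obtain a b A B where ab: "\<And>C. C \<in> \<C> \<Longrightarrow> a C \<in> C" "\<And>C. C \<in> \<C> \<Longrightarrow> b C \<in> C"
    "\<And>C. C \<in> \<C> \<Longrightarrow> A C \<in> F" "\<And>C. C \<in> \<C> \<Longrightarrow> B C \<in> F"
    "\<And>C. C \<in> \<C> \<Longrightarrow> a C \<in> A C" "\<And>C. C \<in> \<C> \<Longrightarrow> b C \<in> B C"
    "\<And>C. C \<in> \<C> \<Longrightarrow> bad C \<Longrightarrow> b C \<notin> A C"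
  proof -
    \<comment> \<open>The four witnesses are packed into nested pairs so that one application of
      choice picks them together.\<close>
    let ?R = "\<lambda>C t. fst t \<in> C \<and> fst (snd t) \<in> C \<and> fst (snd (snd t)) \<in> F \<and> snd (snd (snd t)) \<in> F \<and>
        fst t \<in> fst (snd (snd t)) \<and> fst (snd t) \<in> snd (snd (snd t)) \<and> (bad C \<longrightarrow> fst (snd t) \<notin> fst (snd (snd t)))"
    have "\<forall>C\<in>\<C>. \<exists>t. ?R C t"
    proof
      fix C assume "C \<in> \<C>"
      from ex[OF this] obtain a b A B where "?R C (a, b, A, B)" by auto
      then show "\<exists>t. ?R C t" ..
    qed
    from bchoice[OF this] obtain f where f: "\<forall>C\<in>\<C>. ?R C (f C)" ..
    show thesis
      by (rule that[of "\<lambda>C. fst (f C)" "\<lambda>C. fst (snd (f C))" "\<lambda>C. fst (snd (snd (f C)))" "\<lambda>C. snd (snd (snd (f C)))"])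
        (use f in simp_all)
  qed
  have abX: "a C \<in> X" "b C \<in> X" if "C \<in> \<C>" for C
    using ab(1,2)[OF that] C_sub[OF that] by auto
  have uniq: "C = C'" if "C \<in> \<C>" "C' \<in> \<C>" "z \<in> C" "z \<in> C'" for C C' z
    using that C_cls by metis
  have a_in: "C' = C" if "C \<in> \<C>" "C' \<in> \<C>" "a C' \<in> C" for C C'
    using uniq[OF that(2,1) ab(1)[OF that(2)] that(3)] .
  have b_in: "C' = C" if "C \<in> \<C>" "C' \<in> \<C>" "b C' \<in> C" for C C'
    using uniq[OF that(2,1) ab(2)[OF that(2)] that(3)] .
  define Bad where "Bad = {C \<in> \<C>. bad C}"
  define Good where "Good = {C \<in> \<C>. \<not> bad C}"
  have inj_a: "inj_on a \<C>" by (rule inj_onI) (metis uniq ab(1))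
  have inj_b: "inj_on b \<C>" by (rule inj_onI) (metis uniq ab(2))
  have a_ne_b: "a C \<noteq> b C'" if "C \<in> \<C>" "C' \<in> Bad" for C C'
  proof
    assume eq: "a C = b C'"
    have C': "C' \<in> \<C>" "bad C'" using that by (auto simp: Bad_def)
    have "C = C'" using uniq[OF that(1) C'(1) ab(1)[OF that(1)]] ab(2)[OF C'(1)] eq by simp
    then show False using ab(5)[OF C'(1)] ab(7)[OF C'] eq by simp
  qed
  have cIA: "(\<lambda>x. ind C x * ind G x) \<in> V" if "C \<in> \<C>" "G \<in> F" for C G
    using HV[OF C_ind[OF that(1)]] F[OF that(2)] WV by blast
  define Y where "Y = \<Union>Bad"
  have YX: "Y \<subseteq> X" using C_sub by (auto simp: Y_def Bad_def)
  define m where "m = card \<C>"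
  have card_m: "m = card Good + card Bad"
    unfolding m_def Good_def Bad_def using finC
    by (subst card_Un_disjoint[symmetric]) (auto intro!: arg_cong[of _ _ card])
  let ?P = "nat p"
  \<comment> \<open>Modulo p an element of \<open>H\<close> is constant on each class, so its values
    at the representatives \<open>a C\<close> determine it.\<close>
  have szH: "sz p X H \<le> ?P ^ m"
  proof -
    define \<Phi> where "\<Phi> u = restrict (\<lambda>y. u (a (cls y))) X" for u :: "'a \<Rightarrow> int"
    have "red p X ` H \<subseteq> \<Phi> ` (red p (a ` \<C>) ` H)"
    proof (rule image_subsetI)
      fix h assume h: "h \<in> H"
      have "red p X h = \<Phi> (red p (a ` \<C>) h)"
        unfolding red_def \<Phi>_def
      proof (rule restrict_ext)
        fix y assume y: "y \<in> X"
        then have C: "cls y \<in> \<C>" by (simp add: \<C>_def)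
        then have "a (cls y) \<in> cls y" using ab(1) by blast
        then have "[h y = h (a (cls y))] (mod p)" using h by (auto simp: cls_def)
        then show "h y mod p = restrict (\<lambda>x. h x mod p) (a ` \<C>) (a (cls y))"
          using C by (simp add: cong_def)
      qed
      then show "red p X h \<in> \<Phi> ` (red p (a ` \<C>) ` H)" using h by blast
    qed
    then have "sz p X H \<le> card (\<Phi> ` (red p (a ` \<C>) ` H))"
      unfolding sz_def by (rule card_mono[rotated]) (intro finite_imageI finite_red finC p0)
    also have "\<dots> \<le> sz p (a ` \<C>) H"
      unfolding sz_def by (rule card_image_le) (intro finite_imageI finite_red finC p0)
    also have "\<dots> \<le> ?P ^ card (a ` \<C>)" using finC p0 by (intro sz_le) auto
    finally show ?thesis using inj_a by (simp add: card_image m_def)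
  qed
  have dualI: "\<exists>v\<in>V. [v q = 1] (mod p) \<and> (\<forall>z\<in>Z - {q}. [v z = 0] (mod p))"
    if "v \<in> V" "v q = 1" "\<And>z. z \<in> Z \<Longrightarrow> z \<noteq> q \<Longrightarrow> v z = 0" for v q Z
    using that by (intro bexI[of _ v] conjI ballI) auto
  \<comment> \<open>Evaluation points are \<open>a C\<close> for every class and also
    \<open>b C\<close> for the bad ones, which gives \<open>m + card Bad\<close> independent
    functions in \<open>V\<close>.\<close>
  have szV1: "?P ^ (m + card Bad) \<le> sz p X V"
  proof -
    let ?Q = "a ` \<C> \<union> b ` Bad"
    have "card ?Q = card (a ` \<C>) + card (b ` Bad)"
      using a_ne_b finC by (intro card_Un_disjoint) (auto simp: Bad_def)
    also have "\<dots> = m + card Bad"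
      using inj_a inj_on_subset[OF inj_b, of Bad] by (simp add: card_image m_def Bad_def)
    finally have cQ: "card ?Q = m + card Bad" .
    have "card ((\<lambda>A. A \<inter> {}) ` {{} :: 'a set}) * nat p ^ card ?Q \<le> sz p X V"
    proof (rule sz_ge_dual_system[OF fin p1 V])
      show "?Q \<subseteq> X" using abX by (auto simp: Bad_def)
      show "ind A' \<in> V" if "A' \<in> {{}}" for A' :: "'a set"
        using that msub_zero[OF V] by (simp add: ind_def[abs_def])
      fix q assume "q \<in> ?Q"
      then consider (a) C where "C \<in> \<C>" "q = a C" | (b) C where "C \<in> Bad" "q = b C" by auto
      then show "\<exists>v\<in>V. [v q = 1] (mod p) \<and> (\<forall>z\<in>?Q \<union> {} - {q}. [v z = 0] (mod p))"
      proof cases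
        case a
        let ?v = "\<lambda>x. ind C x * ind (A C) x"
        have "?v q = 1" using a ab by (simp add: ind_def)
        moreover have "?v z = 0" if "z \<in> ?Q" "z \<noteq> q" for z
        proof (cases "z \<in> C")
          case True
          then have "z = b C \<and> C \<in> Bad" using that a a_in[OF \<open>C \<in> \<C>\<close>] b_in[OF \<open>C \<in> \<C>\<close>] by (auto simp: Bad_def)
          then show ?thesis using ab by (auto simp: ind_def Bad_def)
        qed (simp add: ind_def)
        ultimately show ?thesis using cIA[OF a(1) ab(3)[OF a(1)]] by (intro dualI[of ?v]) blast+
      next
        case b
        then have C: "C \<in> \<C>" by (simp add: Bad_def)
        \<comment> \<open>The subtracted multiple cancels the value at \<open>a C\<close>; it does
          not affect \<open>b C\<close>, which lies outside \<open>A C\<close>.\<close>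
        let ?v = "\<lambda>x. ind C x * ind (B C) x - ind (B C) (a C) * (ind C x * ind (A C) x)"
        have "?v q = 1" using b ab C by (simp add: ind_def Bad_def)
        moreover have "?v z = 0" if "z \<in> ?Q" "z \<noteq> q" for z
        proof (cases "z \<in> C")
          case True
          then have "z = a C" using that b a_in[OF \<open>C \<in> \<C>\<close>] b_in[OF \<open>C \<in> \<C>\<close>] by (auto simp: Bad_def)
          then show ?thesis using ab C by (auto simp: ind_def Bad_def)
        qed (simp add: ind_def)
        moreover have "?v \<in> V"
          using msub_diff[OF V cIA[OF C ab(4)[OF C]] msub_scale[OF V cIA[OF C ab(3)[OF C]]]] .
        ultimately show ?thesis by (intro dualI[of ?v]) blast+
      qed
    qed auto
    then show ?thesis by (simp add: cQ)
  qed
  \<comment> \<open>Here the good classes supply the dual functions, while members of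
    \<open>F\<close> with different traces on \<open>Y\<close> differ modulo p.\<close>
  have szV2: "card ((\<lambda>A. A \<inter> Y) ` F) * ?P ^ card Good \<le> sz p X V"
  proof -
    have "card ((\<lambda>A. A \<inter> Y) ` F) * ?P ^ card (a ` Good) \<le> sz p X V"
    proof (rule sz_ge_dual_system[OF fin p1 V _ YX])
      show "a ` Good \<subseteq> X" using abX by (auto simp: Good_def)
      show "ind A' \<in> V" if "A' \<in> F" for A' using F[OF that] WV by auto
      show "a ` Good \<inter> Y = {}"
        unfolding Y_def Good_def Bad_def using ab uniq by blast
      fix q assume "q \<in> a ` Good"
      then obtain C where C: "C \<in> Good" "q = a C" by auto
      then have CC: "C \<in> \<C>" by (simp add: Good_def)
      let ?v = "\<lambda>x. ind C x * ind (A C) x"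
      have "?v q = 1" using C CC ab by (simp add: ind_def)
      moreover have "?v z = 0" if "z \<in> a ` Good \<union> Y - {q}" for z
      proof -
        have "z \<notin> C"
        proof
          assume z: "z \<in> C"
          have "z \<notin> Y" using z C uniq[OF CC] by (auto simp: Y_def Bad_def Good_def)
          then show False using z that C a_in[OF CC] by (auto simp: Good_def)
        qed
        then show ?thesis by (simp add: ind_def)
      qed
      ultimately show "\<exists>v\<in>V. [v q = 1] (mod p) \<and> (\<forall>z\<in>a ` Good \<union> Y - {q}. [v z = 0] (mod p))"
        using cIA[OF CC ab(3)[OF CC]] by (intro dualI[of ?v]) blast+
    qed
    moreover have "card (a ` Good) = card Good"
      using inj_on_subset[OF inj_a, of Good] by (simp add: card_image Good_def)
    ultimately show ?thesis by simp
  qed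
  \<comment> \<open>With w, v the orders of \<open>W\<close>, \<open>V\<close> and t the number of
    traces: \<open>w^2 <= v p^m\<close>, \<open>p^(m + card Bad) <= v\<close> and
    \<open>t p^(card Good) <= v\<close>. The first two give \<open>w^2 p^(card Bad) <= v^2\<close>,
    the first and third \<open>t w^2 <= v^2 p^(card Bad)\<close>; combining them gives
    \<open>t w^4 <= v^4\<close>, whence the exponent 4.\<close>
  have "card ((\<lambda>A. A \<inter> Y) ` F) * sz p X W ^ 4 \<le> sz p X U ^ 4"
  proof -
    let ?w = "sz p X W" and ?v = "sz p X V" and ?u = "sz p X U" and ?t = "card ((\<lambda>A. A \<inter> Y) ` F)"
    have w2: "?w * ?w \<le> ?v * ?P ^ m"
      using mult_le_mono1[OF szS, of ?w] le mult_le_mono2[OF szH, of ?v] unfolding H_def by linarith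
    have vu: "?v \<le> ?u" by (rule sz_mono[OF fin p0 VU])
    have "(?w * ?w) * ?P ^ card Bad \<le> (?v * ?P ^ m) * ?P ^ card Bad" by (rule mult_le_mono1[OF w2])
    also have "\<dots> \<le> ?v * ?v" using mult_le_mono2[OF szV1, of ?v] by (simp only: power_add mult.assoc)
    finally have 1: "(?w * ?w) * ?P ^ card Bad \<le> ?v * ?v" .
    have "?t * (?w * ?w) \<le> ?t * (?v * ?P ^ m)" by (rule mult_le_mono2[OF w2])
    also have "\<dots> = (?t * ?P ^ card Good) * (?v * ?P ^ card Bad)" by (simp add: card_m power_add)
    also have "\<dots> \<le> ?v * (?v * ?P ^ card Bad)" by (rule mult_le_mono1[OF szV2])
    finally have "(?t * (?w * ?w)) * (?w * ?w) \<le> (?v * (?v * ?P ^ card Bad)) * (?w * ?w)"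
      by (rule mult_le_mono1)
    also have "\<dots> = (?v * ?v) * ((?w * ?w) * ?P ^ card Bad)" by (simp add: mult_ac)
    also have "\<dots> \<le> (?v * ?v) * (?v * ?v)" by (rule mult_le_mono2[OF 1])
    also have "\<dots> \<le> (?u * ?u) * (?u * ?u)" by (intro mult_le_mono vu)
    finally show ?thesis by (simp add: numeral_eq_Suc mult_ac)
  qed
  moreover have "\<exists>g\<in>U. \<forall>y\<in>X. [g y = of_bool (\<forall>A\<in>F. x \<in> A \<longleftrightarrow> y \<in> A)] (mod p)" if x: "x \<in> X - Y" for x
  proof -
    have C: "cls x \<in> \<C>" using x by (auto simp: \<C>_def)
    have good: "\<not> bad (cls x)" using x C cls_refl by (auto simp: Y_def Bad_def)
    obtain G where G: "G \<in> F" "x \<in> G" using cover x by blast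
    \<comment> \<open>The value 1 at \<open>x\<close> passes to all twins because functions in
      \<open>U\<close> respect twins; a point that is not a twin of \<open>x\<close> lies outside
      the good class \<open>cls x\<close>.\<close>
    let ?g = "\<lambda>z. ind (cls x) z * ind G z"
    have gU: "?g \<in> U" using cIA[OF C G(1)] VU by blast
    have "?g y = of_bool (\<forall>A\<in>F. x \<in> A \<longleftrightarrow> y \<in> A)" if y: "y \<in> X" for y
    proof (cases "\<forall>A\<in>F. x \<in> A \<longleftrightarrow> y \<in> A")
      case True
      have "[?g x = ?g y] (mod p)" using const[OF gU] x y True by blast
      moreover have "?g x = 1" using x cls_refl G by (simp add: ind_def)
      ultimately have "?g y \<noteq> 0" using p1 by (auto simp: cong_def)
      then show ?thesis using True by (auto simp: ind_def)
    next
      case False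
      have "y \<notin> cls x"
      proof
        assume "y \<in> cls x"
        then show False using False good cls_refl[of x] x unfolding bad_def by blast
      qed
      then show ?thesis using False by (simp add: ind_def)
    qed
    then show ?thesis using gU by (intro bexI[of _ ?g]) auto
  qed
  ultimately show ?thesis using YX by blast
qed

section \<open>Integer combinations of intersections\<close>

text \<open>Coefficients are integers, not residues, so that a combination found modulo p can
  afterwards be studied modulo powers of p.\<close>

inductive_set ispan :: "('a \<Rightarrow> int) set \<Rightarrow> ('a \<Rightarrow> int) set" for G where
  zero: "(\<lambda>x. 0) \<in> ispan G"
| add: "f \<in> ispan G \<Longrightarrow> g \<in> G \<Longrightarrow> (\<lambda>x. f x + g x) \<in> ispan G"
| diff: "f \<in> ispan G \<Longrightarrow> g \<in> G \<Longrightarrow> (\<lambda>x. f x - g x) \<in> ispan G"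

lemma ispan_base: "g \<in> G \<Longrightarrow> g \<in> ispan G"
  using ispan.add[OF ispan.zero, of g G] by simp

lemma ispan_plus:
  assumes "f \<in> ispan G" "g \<in> ispan G"
  shows "(\<lambda>x. f x + g x) \<in> ispan G"
  using assms(2)
proof induction
  case (add h g)
  from ispan.add[OF add.IH add.hyps(2)] show ?case by (simp add: add.assoc)
next
  case (diff h g)
  from ispan.diff[OF diff.IH diff.hyps(2)] show ?case by (simp add: add_diff_eq)
qed (use assms(1) in simp)

lemma ispan_minus:
  assumes "f \<in> ispan G" "g \<in> ispan G"
  shows "(\<lambda>x. f x - g x) \<in> ispan G"
  using assms(2)
proof induction
  case (add h g)
  from ispan.diff[OF add.IH add.hyps(2)] show ?case by (simp add: diff_diff_eq)
next
  case (diff h g)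
  from ispan.add[OF diff.IH diff.hyps(2)] show ?case by (simp add: algebra_simps)
qed (use assms(1) in simp)

lemma ispan_mono:
  assumes "G \<subseteq> H" "f \<in> ispan G"
  shows "f \<in> ispan H"
  using assms(2) by induction (use assms(1) in \<open>auto intro: ispan.intros\<close>)

lemma ispan_times:
  assumes "\<And>f g. f \<in> G \<Longrightarrow> g \<in> H \<Longrightarrow> (\<lambda>x. f x * g x) \<in> ispan K"
    and f: "f \<in> ispan G" and g: "g \<in> ispan H"
  shows "(\<lambda>x. f x * g x) \<in> ispan K"
proof -
  have base: "(\<lambda>x. f x * g x) \<in> ispan K" if "f \<in> G" for f
    using g
  proof induction
    case (add h g)
    from ispan_plus[OF add.IH assms(1)[OF that add.hyps(2)]] show ?case by (simp add: distrib_left)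
  next
    case (diff h g)
    from ispan_minus[OF diff.IH assms(1)[OF that diff.hyps(2)]] show ?case by (simp add: right_diff_distrib)
  qed (simp add: ispan.zero)
  show ?thesis
    using f
  proof induction
    case (add h f)
    from ispan_plus[OF add.IH base[OF add.hyps(2)]] show ?case by (simp add: distrib_right)
  next
    case (diff h f)
    from ispan_minus[OF diff.IH base[OF diff.hyps(2)]] show ?case by (simp add: left_diff_distrib)
  qed (simp add: ispan.zero)
qed

lemma ispan_sum_dvd:
  assumes "f \<in> ispan G" "\<And>g. g \<in> G \<Longrightarrow> d dvd (\<Sum>x\<in>A. g x)"
  shows "d dvd (\<Sum>x\<in>A. f x)"
  using assms(1) by induction (use assms(2) in \<open>auto simp: sum.distrib sum_subtractf\<close>)

lemma ispan_eq:
  assumes "f \<in> ispan G" "\<And>g. g \<in> G \<Longrightarrow> g x = g y"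
  shows "f x = f y"
  using assms(1) by induction (use assms(2) in auto)

section \<open>Twins and intersections of boundedly many members\<close>

definition meets :: "'a set set \<Rightarrow> nat \<Rightarrow> 'a set set" where
  "meets F j = {\<Inter>G | G. G \<subseteq> F \<and> G \<noteq> {} \<and> finite G \<and> card G \<le> j}"

text \<open>Since \<open>meets\<close> excludes the empty intersection, the constant 1 need not lie
  in this span; only polynomials without constant term may be applied to its elements.\<close>

definition meet_span :: "'a set set \<Rightarrow> nat \<Rightarrow> ('a \<Rightarrow> int) set" where
  "meet_span F j = ispan (ind ` meets F j)"

definition twin :: "'a set set \<Rightarrow> 'a \<Rightarrow> 'a \<Rightarrow> bool" where
  "twin F x y \<longleftrightarrow> (\<forall>A\<in>F. x \<in> A \<longleftrightarrow> y \<in> A)"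

lemma meets_mono: "i \<le> j \<Longrightarrow> meets F i \<subseteq> meets F j"
  unfolding meets_def using order_trans by blast

lemma meet_span_mono: "i \<le> j \<Longrightarrow> f \<in> meet_span F i \<Longrightarrow> f \<in> meet_span F j"
  unfolding meet_span_def using ispan_mono meets_mono image_mono by metis

lemma ind_Int: "ind (A \<inter> B) x = ind A x * ind B x"
  by (simp add: ind_def)

lemma meets_Int:
  assumes "A \<in> meets F i" "B \<in> meets F j"
  shows "A \<inter> B \<in> meets F (i + j)"
proof -
  obtain G H where G: "A = \<Inter>G" "G \<subseteq> F" "G \<noteq> {}" "finite G" "card G \<le> i"
    and H: "B = \<Inter>H" "H \<subseteq> F" "H \<noteq> {}" "finite H" "card H \<le> j"
    using assms by (auto simp: meets_def)
  have "card (G \<union> H) \<le> i + j" using card_Un_le[of G H] G H by linarith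
  moreover have "A \<inter> B = \<Inter>(G \<union> H)" using G H by auto
  ultimately show ?thesis unfolding meets_def using G H by (intro CollectI exI[of _ "G \<union> H"]) auto
qed

lemma meet_span_times:
  assumes "f \<in> meet_span F i" "g \<in> meet_span F j"
  shows "(\<lambda>x. f x * g x) \<in> meet_span F (i + j)"
  using assms unfolding meet_span_def
proof (rule ispan_times[rotated])
  fix f g :: "'a \<Rightarrow> int" assume "f \<in> ind ` meets F i" "g \<in> ind ` meets F j"
  then obtain A B where A: "A \<in> meets F i" "B \<in> meets F j" "f = ind A" "g = ind B" by auto
  then have "(\<lambda>x. f x * g x) = ind (A \<inter> B)" by (simp add: ind_Int fun_eq_iff)
  then show "(\<lambda>x. f x * g x) \<in> ispan (ind ` meets F (i + j))"
    using meets_Int[OF A(1,2)] by (simp add: ispan_base)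
qed

lemma meet_span_power:
  assumes "f \<in> meet_span F j" "m > 0"
  shows "(\<lambda>x. f x ^ m) \<in> meet_span F (j * m)"
  using assms(2)
proof (induction m rule: nat_induct_non_zero)
  case (Suc m)
  from meet_span_times[OF assms(1) Suc.IH] show ?case by simp
qed (use assms(1) in simp)

text \<open>The polynomial \<open>1 - (1 - t)^m\<close> has no constant term. Writing
  \<open>u\<close> for its value, the next power gives \<open>u + f - f * u\<close>, which stays in
  the span.\<close>

lemma meet_span_one_minus_power:
  assumes "f \<in> meet_span F j"
  shows "(\<lambda>x. 1 - (1 - f x) ^ m) \<in> meet_span F (j * m)"
proof (induction m)
  case 0
  then show ?case by (simp add: meet_span_def ispan.zero)
next
  case (Suc m)
  let ?u = "\<lambda>x. 1 - (1 - f x) ^ m"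
  have "?u \<in> meet_span F (j * Suc m)" "f \<in> meet_span F (j * Suc m)"
    using meet_span_mono[OF _ Suc.IH, of "j * Suc m"] meet_span_mono[OF _ assms(1), of "j * Suc m"] by auto
  moreover have "(\<lambda>x. f x * ?u x) \<in> meet_span F (j * Suc m)"
    using meet_span_times[OF assms Suc.IH] by simp
  ultimately have "(\<lambda>x. ?u x + f x - f x * ?u x) \<in> meet_span F (j * Suc m)"
    unfolding meet_span_def by (rule ispan_minus[OF ispan_plus])
  moreover have "(\<lambda>x. ?u x + f x - f x * ?u x) = (\<lambda>x. 1 - (1 - f x) ^ Suc m)"
    by (simp add: fun_eq_iff algebra_simps)
  ultimately show ?case by simp
qed

lemma meet_span_twin:
  assumes "f \<in> meet_span F j" "twin F x y"
  shows "f x = f y"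
  using assms(1) unfolding meet_span_def
proof (rule ispan_eq)
  fix g :: "'a \<Rightarrow> int" assume "g \<in> ind ` meets F j"
  then obtain G where "G \<subseteq> F" "g = ind (\<Inter>G)" by (auto simp: meets_def)
  then show "g x = g y" using assms(2) by (auto simp: ind_def twin_def)
qed

section \<open>Divisibility of the size of an isolated class\<close>

lemma sum_ind: "finite A \<Longrightarrow> (\<Sum>x\<in>A. ind B x) = int (card (B \<inter> A))"
  by (simp add: ind_def of_bool_def sum.If_cases Int_commute flip: Int_def)

definition isolated :: "'a set set \<Rightarrow> 'a set \<Rightarrow> nat \<Rightarrow> nat \<Rightarrow> 'a \<Rightarrow> bool" where
  "isolated F X j l x \<longleftrightarrow> (\<forall>p. prime p \<longrightarrow> p dvd l \<longrightarrow>
     (\<exists>g\<in>meet_span F j. \<forall>y\<in>X. [g y = of_bool (twin F x y)] (mod int p)))"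

text \<open>Lifts an indicator modulo \<open>p\<close> to one modulo a power of \<open>p\<close> by a polynomial without constant term.\<close>

lemma cong_idempotent_power:
  fixes g :: int
  assumes "[g = of_bool P] (mod p)" "m > 0"
  shows "[1 - (1 - g ^ m) ^ m = of_bool P] (mod p ^ m)"
proof (cases P)
  case True
  then have "[g ^ m = 1 ^ m] (mod p)" using assms(1) by (intro cong_pow) simp
  then have "p dvd 1 - g ^ m" by (metis cong_iff_dvd_diff cong_sym power_one)
  then have "p ^ m dvd (1 - g ^ m) ^ m" by (rule dvd_power_same)
  then show ?thesis using True by (simp add: cong_iff_dvd_diff)
next
  case False
  then have "p dvd g" using assms(1) by (simp add: cong_0_iff)
  then have "p ^ m dvd g ^ m" by (rule dvd_power_same)
  then have "[(1 - g ^ m) ^ m = (1 - 0) ^ m] (mod p ^ m)"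
    by (intro cong_pow cong_diff) (auto simp: cong_0_iff)
  then show ?thesis using False by (simp add: cong_iff_dvd_diff) (metis dvd_minus_iff minus_diff_eq)
qed

text \<open>For a prime \<open>p\<close> dividing \<open>l\<close>, the polynomial
  \<open>1 - (1 - g^l)^l\<close> turns the indicator modulo \<open>p\<close> into one modulo
  \<open>p^l\<close>, and it is an integer combination of intersections of at most
  \<open>j * l * l\<close> members. Summing it over \<open>A\<close> transfers divisibility from
  these intersections to the class. The set \<open>A\<close> is left free so that it can be either
  the whole ground set or an intersection of members.\<close>

lemma isolated_dvd:
  assumes iso: "isolated F X j l x" and l: "l > 0" and X: "finite X" and x: "x \<in> X"
    and A: "A \<subseteq> X" "{y \<in> X. twin F x y} \<subseteq> A"
    and dvd: "\<And>G. G \<in> meets F (j * l * l) \<Longrightarrow> l dvd card (G \<inter> A)"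
  shows "l dvd card {y \<in> X. twin F x y}"
proof (rule multiplicity_le_imp_dvd)
  let ?D = "{y \<in> X. twin F x y}"
  have finA: "finite A" using A X finite_subset by blast
  show "l \<noteq> 0" using l by simp
  have "card ?D > 0" using x X by (auto simp: card_gt_0_iff twin_def)
  fix p :: nat assume p: "prime p"
  show "multiplicity p l \<le> multiplicity p (card ?D)"
  proof (cases "p dvd l")
    case False
    then show ?thesis by (simp add: not_dvd_imp_multiplicity_0)
  next
    case True
    define a where "a = multiplicity p l"
    have pa: "p ^ a dvd l" unfolding a_def by (rule multiplicity_dvd)
    \<comment> \<open>The multiplicity \<open>a\<close> is at most \<open>l\<close>, so one exponent
      \<open>l\<close> serves all primes.\<close>
    then have "p ^ a \<le> l" using l by (simp add: dvd_imp_le)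
    moreover have "a < 2 ^ a" by (rule less_exp)
    moreover have "(2::nat) ^ a \<le> p ^ a" using p by (simp add: power_mono prime_ge_2_nat)
    ultimately have al: "a \<le> l" by linarith
    obtain g where g: "g \<in> meet_span F j" "\<And>y. y \<in> X \<Longrightarrow> [g y = of_bool (twin F x y)] (mod int p)"
      using iso p True by (auto simp: isolated_def)
    define h where "h y = 1 - (1 - g y ^ l) ^ l" for y
    have "h \<in> meet_span F (j * l * l)"
      unfolding h_def using meet_span_one_minus_power[OF meet_span_power[OF g(1) l]] .
    then have "int l dvd (\<Sum>y\<in>A. h y)"
      unfolding meet_span_def
    proof (rule ispan_sum_dvd)
      fix f :: "'a \<Rightarrow> int" assume "f \<in> ind ` meets F (j * l * l)"
      then show "int l dvd (\<Sum>y\<in>A. f y)" using dvd finA by (auto simp: sum_ind)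
    qed
    then have "int p ^ a dvd (\<Sum>y\<in>A. h y)" using pa by (metis dvd_trans of_nat_dvd_iff of_nat_power)
    moreover have "[(\<Sum>y\<in>A. h y) = (\<Sum>y\<in>A. ind ?D y)] (mod int p ^ l)"
    proof (rule cong_sum)
      fix y assume "y \<in> A"
      then have "y \<in> X" using A by auto
      then show "[h y = ind ?D y] (mod int p ^ l)"
        using cong_idempotent_power[OF g(2) l] by (simp add: h_def ind_def)
    qed
    then have "[(\<Sum>y\<in>A. h y) = (\<Sum>y\<in>A. ind ?D y)] (mod int p ^ a)"
      by (rule cong_dvd_modulus) (use al in \<open>simp add: le_imp_power_dvd\<close>)
    ultimately have "int p ^ a dvd (\<Sum>y\<in>A. ind ?D y)" using cong_dvd_iff by blast
    then have "int p ^ a dvd int (card (?D \<inter> A))" using finA by (simp add: sum_ind)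
    moreover have "?D \<inter> A = ?D" using A by auto
    ultimately have "p ^ a dvd card ?D" by (metis of_nat_dvd_iff of_nat_power)
    then show ?thesis unfolding a_def[symmetric]
      using p \<open>card ?D > 0\<close> by (intro multiplicity_geI) (auto dest: prime_gt_1_nat)
  qed
qed

section \<open>A common scale for all primes dividing l\<close>

text \<open>If each of the \<open>M\<close> steps grew by more than the M-th root of
  \<open>K\<close>, then \<open>f M\<close> would exceed \<open>K\<close>.\<close>

lemma pigeonhole_growth:
  fixes f :: "nat \<Rightarrow> nat"
  assumes "M > 0" "f 0 > 0" "f M \<le> K"
  shows "\<exists>i<M. f (Suc i) ^ M \<le> K * f i ^ M"
proof (rule ccontr)
  assume neg: "\<not> ?thesis"
  have "i \<le> M \<Longrightarrow> K ^ i \<le> f i ^ M \<and> (i > 0 \<longrightarrow> K ^ i < f i ^ M)" for i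
  proof (induction i)
    case (Suc i)
    have "K ^ Suc i \<le> K * f i ^ M" using Suc by simp
    also have "\<dots> < f (Suc i) ^ M" using neg Suc.prems by (auto simp: not_le)
    finally show ?case by simp
  qed (use assms in simp)
  from this[of M] have "K ^ M < f M ^ M" using assms(1) by simp
  moreover have "f M ^ M \<le> K ^ M" using assms(3) by (rule power_mono) simp
  ultimately show False by simp
qed

text \<open>The number of doublings \<open>32 l\<^sup>3\<close> makes the pigeonhole loss at most \<open>2\<^sup>n\<^sup>/\<^sup>8\<^sup>l\<close> traces.\<close>

definition iso_degree :: "nat \<Rightarrow> nat" where
  "iso_degree l = 2 ^ (32 * l ^ 3)"

text \<open>The orders for all primes are multiplied into one quantity, so that the pigeonhole
  principle finds a single \<open>i\<close> at which the total growth is small. The exceptional sets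
  of the primes are united, and the numbers of traces on them multiply.\<close>

lemma isolated_structure:
  assumes l: "l > 0" and X: "finite X" and cover: "\<And>x. x \<in> X \<Longrightarrow> \<exists>A\<in>F. x \<in> A"
  shows "\<exists>Z\<subseteq>X. (\<forall>x\<in>Z. isolated F X (iso_degree l) l x) \<and>
    card ((\<lambda>A. A \<inter> (X - Z)) ` F) ^ (8 * l) \<le> 2 ^ card X"
proof -
  define M where "M = 32 * l ^ 3"
  \<comment> \<open>An upper bound for a product of at most \<open>l\<close> orders, each at most
    \<open>(2 ^ l) ^ card X\<close>.\<close>
  define K where "K = (2::nat) ^ (card X * l\<^sup>2)"
  define P where "P = {p. prime p \<and> p dvd l}"
  have P_le: "p \<le> l" "p > 1" if "p \<in> P" for p
    using that l dvd_imp_le prime_gt_1_nat by (auto simp: P_def)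
  have "P \<subseteq> {1..l}" using P_le by force
  then have finP: "finite P" and cardP: "card P \<le> l"
    using finite_subset[of P "{1..l}"] card_mono[of "{1..l}" P] by auto
  \<comment> \<open>Degrees are powers of two, so a product of two functions of level
    \<open>i\<close> has level \<open>i + 1\<close>.\<close>
  define W where "W p i = {f. \<exists>g\<in>meet_span F (2 ^ i). \<forall>x\<in>X. [f x = g x] (mod int p)}" for p :: nat and i
  have Wsub: "msub (int p) X (W p i)" for p i
    unfolding msub_def
  proof (intro conjI ballI allI impI)
    fix f g assume "f \<in> W p i" "g \<in> W p i"
    then obtain f' g' where fg: "f' \<in> meet_span F (2 ^ i)" "g' \<in> meet_span F (2 ^ i)"
      "\<forall>x\<in>X. [f x = f' x] (mod int p)" "\<forall>x\<in>X. [g x = g' x] (mod int p)" by (auto simp: W_def)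
    have "(\<lambda>x. f' x - g' x) \<in> meet_span F (2 ^ i)" using fg unfolding meet_span_def by (intro ispan_minus)
    then show "(\<lambda>x. f x - g x) \<in> W p i" unfolding W_def
      by (intro CollectI bexI[of _ "\<lambda>x. f' x - g' x"]) (use fg in \<open>auto intro: cong_diff\<close>)
  next
    fix f :: "'a \<Rightarrow> int" assume "\<forall>x\<in>X. [f x = 0] (mod int p)"
    then show "f \<in> W p i" unfolding W_def meet_span_def
      by (intro CollectI bexI[of _ "\<lambda>x. 0"] ispan.zero)
  qed
  have Wmono: "W p i \<subseteq> W p (Suc i)" for p i
    unfolding W_def using meet_span_mono[of "2 ^ i" "2 ^ Suc i" _ F] by auto
  define f where "f i = (\<Prod>p\<in>P. sz (int p) X (W p i))" for i
  have "\<exists>i<M. f (Suc i) ^ M \<le> K * f i ^ M"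
  proof (rule pigeonhole_growth)
    show "M > 0" using l by (simp add: M_def)
    show "f 0 > 0" unfolding f_def
    proof (rule prod_pos)
      fix p assume p: "p \<in> P"
      have "W p 0 \<noteq> {}" using msub_zero[OF Wsub[of p 0]] by blast
      then show "0 < sz (int p) X (W p 0)" using P_le[OF p] by (intro sz_pos[OF X]) auto
    qed
    have "f M \<le> (\<Prod>p\<in>P. 2 ^ (l * card X))"
      unfolding f_def
    proof (rule prod_mono, safe)
      fix p assume p: "p \<in> P"
      have "sz (int p) X (W p M) \<le> nat (int p) ^ card X" using P_le[OF p] by (intro sz_le[OF X]) auto
      also have "\<dots> \<le> (2 ^ l) ^ card X"
      proof (rule power_mono)
        show "nat (int p) \<le> 2 ^ l" using P_le[OF p] less_exp[of l] by linarith
      qed simp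
      finally show "sz (int p) X (W p M) \<le> 2 ^ (l * card X)" by (simp add: power_mult)
    qed
    also have "\<dots> = 2 ^ (l * card X * card P)" by (simp add: power_mult)
    also have "\<dots> \<le> 2 ^ (l * card X * l)" using cardP by (intro power_increasing) auto
    also have "\<dots> = K" by (simp add: K_def power2_eq_square mult_ac)
    finally show "f M \<le> K" .
  qed
  then obtain i where i: "i < M" and growth: "f (Suc i) ^ M \<le> K * f i ^ M" by auto
  have step: "\<exists>Y\<subseteq>X. card ((\<lambda>A. A \<inter> Y) ` F) * sz (int p) X (W p i) ^ 4 \<le> sz (int p) X (W p (Suc i)) ^ 4 \<and>
    (\<forall>x\<in>X - Y. \<exists>g\<in>W p (Suc i). \<forall>y\<in>X. [g y = of_bool (\<forall>A\<in>F. x \<in> A \<longleftrightarrow> y \<in> A)] (mod int p))"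
    if p: "p \<in> P" for p
  proof (rule mod_prime_step[OF X _ Wsub Wsub Wmono])
    show "prime (int p)" using p by (simp add: P_def)
    show "\<exists>A\<in>F. x \<in> A" if "x \<in> X" for x using cover[OF that] .
    show "ind A \<in> W p i" if "A \<in> F" for A
    proof -
      have "\<Inter>{A} \<in> meets F (2 ^ i)" unfolding meets_def using that by (intro CollectI exI[of _ "{A}"]) auto
      then have "ind A \<in> meet_span F (2 ^ i)" unfolding meet_span_def by (intro ispan_base) auto
      then show ?thesis unfolding W_def by (intro CollectI bexI[of _ "ind A"]) auto
    qed
    show "(\<lambda>x. f x * g x) \<in> W p (Suc i)" if fgW: "f \<in> W p i" "g \<in> W p i" for f g
    proof -
      obtain f' g' where fg: "f' \<in> meet_span F (2 ^ i)" "g' \<in> meet_span F (2 ^ i)"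
        "\<forall>x\<in>X. [f x = f' x] (mod int p)" "\<forall>x\<in>X. [g x = g' x] (mod int p)" using fgW by (auto simp: W_def)
      have "(\<lambda>x. f' x * g' x) \<in> meet_span F (2 ^ Suc i)" using meet_span_times[OF fg(1,2)] by (simp add: mult_2)
      then show ?thesis unfolding W_def
        by (intro CollectI bexI[of _ "\<lambda>x. f' x * g' x"]) (use fg in \<open>auto intro: cong_mult\<close>)
    qed
    show "[f x = f y] (mod int p)"
      if fW: "f \<in> W p (Suc i)" and xy: "x \<in> X" "y \<in> X" "\<forall>A\<in>F. (x \<in> A) = (y \<in> A)" for f x y
    proof -
      obtain f' where f': "f' \<in> meet_span F (2 ^ Suc i)" "\<forall>x\<in>X. [f x = f' x] (mod int p)"
        using fW by (auto simp: W_def)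
      have "f' x = f' y" using meet_span_twin[OF f'(1)] xy by (simp add: twin_def)
      then show ?thesis using f'(2) xy by (simp add: cong_def)
    qed
  qed
  define good where "good p Y \<longleftrightarrow> Y \<subseteq> X \<and> card ((\<lambda>A. A \<inter> Y) ` F) * sz (int p) X (W p i) ^ 4 \<le> sz (int p) X (W p (Suc i)) ^ 4 \<and>
    (\<forall>x\<in>X - Y. \<exists>g\<in>W p (Suc i). \<forall>y\<in>X. [g y = of_bool (\<forall>A\<in>F. x \<in> A \<longleftrightarrow> y \<in> A)] (mod int p))" for p Y
  have "\<forall>p\<in>P. \<exists>Y. good p Y" using step unfolding good_def by blast
  from bchoice[OF this] obtain Y where Y: "\<And>p. p \<in> P \<Longrightarrow> good p (Y p)" by blast
  define Z where "Z = X - (\<Union>p\<in>P. Y p)"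
  have XZ: "X - Z = (\<Union>p\<in>P. Y p)" using Y by (auto simp: Z_def good_def)
  let ?t = "card ((\<lambda>A. A \<inter> (X - Z)) ` F)" and ?s = "\<lambda>p. card ((\<lambda>A. A \<inter> Y p) ` F)"
  have fin_s: "finite ((\<lambda>A. A \<inter> Y p) ` F)" if "p \<in> P" for p
    by (rule finite_subset[of _ "Pow X"]) (use Y[OF that] X in \<open>auto simp: good_def\<close>)
  have t_le: "?t \<le> (\<Prod>p\<in>P. ?s p)"
  proof -
    let ?\<Phi> = "\<lambda>B. restrict (\<lambda>p. B \<inter> Y p) P"
    have "?t \<le> card (Pi\<^sub>E P (\<lambda>p. (\<lambda>A. A \<inter> Y p) ` F))"
    proof (rule card_inj_on_le[of ?\<Phi>])
      show "inj_on ?\<Phi> ((\<lambda>A. A \<inter> (X - Z)) ` F)"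
      proof (rule inj_onI)
        fix B C assume B: "B \<in> (\<lambda>A. A \<inter> (X - Z)) ` F" and C: "C \<in> (\<lambda>A. A \<inter> (X - Z)) ` F" and eq: "?\<Phi> B = ?\<Phi> C"
        have "B \<inter> Y p = C \<inter> Y p" if "p \<in> P" for p using fun_cong[OF eq, of p] that by simp
        moreover have "B \<subseteq> (\<Union>p\<in>P. Y p)" "C \<subseteq> (\<Union>p\<in>P. Y p)" using B C by (auto simp: XZ)
        ultimately show "B = C" by blast
      qed
      show "?\<Phi> ` (\<lambda>A. A \<inter> (X - Z)) ` F \<subseteq> Pi\<^sub>E P (\<lambda>p. (\<lambda>A. A \<inter> Y p) ` F)"
      proof clarify
        fix A assume A: "A \<in> F"
        show "?\<Phi> (A \<inter> (X - Z)) \<in> Pi\<^sub>E P (\<lambda>p. (\<lambda>A. A \<inter> Y p) ` F)"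
          unfolding restrict_PiE_iff
        proof
          fix p assume "p \<in> P"
          then have "A \<inter> (X - Z) \<inter> Y p = A \<inter> Y p" by (auto simp: XZ)
          then show "A \<inter> (X - Z) \<inter> Y p \<in> (\<lambda>A. A \<inter> Y p) ` F" using A by simp
        qed
      qed
      show "finite (Pi\<^sub>E P (\<lambda>p. (\<lambda>A. A \<inter> Y p) ` F))" using finP fin_s by (intro finite_PiE)
    qed
    then show ?thesis using finP by (simp add: card_PiE)
  qed
  have "(\<Prod>p\<in>P. ?s p) * f i ^ 4 \<le> f (Suc i) ^ 4"
  proof -
    have "(\<Prod>p\<in>P. ?s p * sz (int p) X (W p i) ^ 4) \<le> (\<Prod>p\<in>P. sz (int p) X (W p (Suc i)) ^ 4)"
      by (rule prod_mono) (use Y in \<open>auto simp: good_def\<close>)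
    then show ?thesis by (simp add: f_def prod.distrib prod_power_distrib)
  qed
  then have "?t * f i ^ 4 \<le> f (Suc i) ^ 4"
    using mult_le_mono1[OF t_le, of "f i ^ 4"] by linarith
  then have "(?t * f i ^ 4) ^ M \<le> (f (Suc i) ^ 4) ^ M" by (rule power_mono) simp
  also have "\<dots> = (f (Suc i) ^ M) ^ 4" by (simp add: mult.commute flip: power_mult)
  also have "\<dots> \<le> (K * f i ^ M) ^ 4" by (rule power_mono[OF growth]) simp
  finally have "?t ^ M * (f i ^ M) ^ 4 \<le> K ^ 4 * (f i ^ M) ^ 4"
    by (simp add: power_mult_distrib mult.commute flip: power_mult)
  moreover have "f i > 0" unfolding f_def
  proof (rule prod_pos)
    fix p assume p: "p \<in> P"
    have "W p i \<noteq> {}" using msub_zero[OF Wsub[of p i]] by blast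
    then show "0 < sz (int p) X (W p i)" using P_le[OF p] by (intro sz_pos[OF X]) auto
  qed
  ultimately have "?t ^ M \<le> K ^ 4" by simp
  \<comment> \<open>As \<open>M = 8 * l * 4 * l^2\<close> and \<open>K^4\<close> is the
    \<open>4 * l^2\<close>-th power of \<open>2 ^ card X\<close>, a root of order
    \<open>4 * l^2\<close> can be taken.\<close>
  moreover have "?t ^ M = (?t ^ (8 * l)) ^ (4 * l\<^sup>2)"
    by (simp add: M_def flip: power_mult) (simp add: power2_eq_square power3_eq_cube mult_ac)
  moreover have "K ^ 4 = (2 ^ card X) ^ (4 * l\<^sup>2)"
    by (simp add: K_def mult_ac flip: power_mult)
  ultimately have "(?t ^ (8 * l)) ^ (4 * l\<^sup>2) \<le> (2 ^ card X) ^ (4 * l\<^sup>2)" by simp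
  then have "?t ^ (8 * l) \<le> 2 ^ card X" using l by (subst (asm) power_mono_iff) auto
  moreover have "isolated F X (iso_degree l) l x" if x: "x \<in> Z" for x
    unfolding isolated_def
  proof (intro allI impI)
    fix p :: nat assume "prime p" "p dvd l"
    then have p: "p \<in> P" by (simp add: P_def)
    then have "x \<in> X - Y p" using x by (auto simp: Z_def)
    then obtain g where g: "g \<in> W p (Suc i)" "\<forall>y\<in>X. [g y = of_bool (\<forall>A\<in>F. x \<in> A \<longleftrightarrow> y \<in> A)] (mod int p)"
      using Y[OF p] unfolding good_def by blast
    then obtain g' where g': "g' \<in> meet_span F (2 ^ Suc i)" "\<forall>y\<in>X. [g y = g' y] (mod int p)"
      by (auto simp: W_def)
    have "(2::nat) ^ Suc i \<le> iso_degree l"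
      unfolding iso_degree_def M_def[symmetric] using i by (intro power_increasing) auto
    from meet_span_mono[OF this g'(1)] have "g' \<in> meet_span F (iso_degree l)" .
    moreover have "\<forall>y\<in>X. [g' y = of_bool (twin F x y)] (mod int p)"
      using g(2) g'(2) unfolding twin_def by (auto simp: cong_def)
    ultimately show "\<exists>g\<in>meet_span F (iso_degree l). \<forall>y\<in>X. [g y = of_bool (twin F x y)] (mod int p)" by blast
  qed
  ultimately show ?thesis by (intro exI[of _ Z]) (auto simp: Z_def)
qed

section \<open>Families with divisible intersections\<close>

definition tclass :: "'a set set \<Rightarrow> 'a set \<Rightarrow> 'a \<Rightarrow> 'a set" where
  "tclass F X x = {y \<in> X. twin F x y}"

lemma twin_refl: "twin F x x"
  by (simp add: twin_def)

lemma twin_sym: "twin F x y \<Longrightarrow> twin F y x"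
  by (simp add: twin_def)

lemma twin_trans: "twin F x y \<Longrightarrow> twin F y z \<Longrightarrow> twin F x z"
  by (simp add: twin_def)

lemma tclass_eq_iff:
  assumes "x \<in> X" "y \<in> X"
  shows "tclass F X x = tclass F X y \<longleftrightarrow> twin F x y"
  using assms twin_refl[of F] twin_sym[of F] twin_trans[of F] unfolding tclass_def by blast

lemma tclass_disjoint:
  assumes "tclass F X x \<noteq> tclass F X y"
  shows "tclass F X x \<inter> tclass F X y = {}"
  using assms twin_sym[of F] twin_trans[of F] unfolding tclass_def by blast

text \<open>A twin of a covered point is itself covered; this permits passing to the union of
  \<open>F\<close>, where the covering hypothesis holds.\<close>

lemma tclass_Union:
  assumes "F \<subseteq> Pow X" "x \<in> \<Union>F"
  shows "tclass F (\<Union>F) x = tclass F X x"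
  using assms unfolding tclass_def twin_def by blast

lemma card_Union_tclass:
  assumes X: "finite X" and Y: "Y \<subseteq> X" and m: "\<And>x. x \<in> Y \<Longrightarrow> m \<le> card (tclass F X x)"
  shows "m * card (tclass F X ` Y) \<le> card X"
proof -
  have fin: "finite Y" using X Y finite_subset by blast
  have "m * card (tclass F X ` Y) = (\<Sum>D\<in>tclass F X ` Y. m)" by simp
  also have "\<dots> \<le> (\<Sum>D\<in>tclass F X ` Y. card D)" by (rule sum_mono) (use m in auto)
  also have "\<dots> = card (\<Union>(tclass F X ` Y))"
  proof (rule card_Union_disjoint[symmetric])
    show "pairwise disjnt (tclass F X ` Y)"
      using tclass_disjoint[of F X] unfolding pairwise_def disjnt_def by blast
    show "finite D" if "D \<in> tclass F X ` Y" for D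
      using that X by (auto simp: tclass_def)
  qed
  also have "\<dots> \<le> card X" using X by (intro card_mono) (auto simp: tclass_def)
  finally show ?thesis .
qed

text \<open>A member of \<open>F'\<close> is determined by the classes in \<open>Z'\<close> that it
  meets and its trace off \<open>Z\<close>. Such classes have at least \<open>2 * l\<close> points,
  so their number \<open>c\<close> satisfies \<open>8 * l * c <= 4 * card X\<close>; the traces add
  one more \<open>card X\<close> to the exponent. Isolation refers to \<open>F\<close> but the count
  to subfamilies, so that members through classes of bad size can be discarded later.\<close>

lemma isolated_family_bound:
  assumes l: "l > 0" and X: "finite X" and F: "F \<subseteq> Pow X"
  shows "\<exists>Z\<subseteq>\<Union>F. (\<forall>x\<in>Z. isolated F (\<Union>F) (iso_degree l) l x) \<and>
    (\<forall>F'\<subseteq>F. (\<forall>A\<in>F'. \<forall>x\<in>A \<inter> Z. 2 * l \<le> card (tclass F X x)) \<longrightarrow>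
      card F' ^ (8 * l) \<le> 2 ^ (5 * card X) \<and> (card X < 2 * l \<longrightarrow> card F' \<le> 1))"
proof -
  define X0 where "X0 = \<Union>F"
  have X0: "X0 \<subseteq> X" using F by (auto simp: X0_def)
  then have finX0: "finite X0" using X finite_subset by blast
  obtain Z where Z: "Z \<subseteq> X0" "\<forall>x\<in>Z. isolated F X0 (iso_degree l) l x"
    and traces: "card ((\<lambda>A. A \<inter> (X0 - Z)) ` F) ^ (8 * l) \<le> 2 ^ card X0"
    using isolated_structure[OF l finX0, of F] by (auto simp: X0_def)
  have "card F' ^ (8 * l) \<le> 2 ^ (5 * card X) \<and> (card X < 2 * l \<longrightarrow> card F' \<le> 1)"
    if F': "F' \<subseteq> F" and big: "\<forall>A\<in>F'. \<forall>x\<in>A \<inter> Z. 2 * l \<le> card (tclass F X x)" for F'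
  proof -
    define Z' where "Z' = {x \<in> Z. 2 * l \<le> card (tclass F X x)}"
    define c where "c = card (tclass F X ` Z')"
    let ?t = "card ((\<lambda>A. A \<inter> (X0 - Z)) ` F)"
    have Z'X: "Z' \<subseteq> X" using Z X0 by (auto simp: Z'_def)
    then have finZ': "finite Z'" using X finite_subset by blast
    have c: "2 * l * c \<le> card X"
      unfolding c_def by (rule card_Union_tclass[OF X Z'X]) (simp add: Z'_def)
    let ?\<Phi> = "\<lambda>A. (tclass F X ` (A \<inter> Z'), A \<inter> (X0 - Z))"
    have finT: "finite ((\<lambda>A. A \<inter> (X0 - Z)) ` F)"
      by (rule finite_subset[of _ "Pow X0"]) (use finX0 in auto)
    have "card F' \<le> card (Pow (tclass F X ` Z') \<times> (\<lambda>A. A \<inter> (X0 - Z)) ` F)"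
    proof (rule card_inj_on_le[of ?\<Phi>])
      have sub: "A \<subseteq> B" if A: "A \<in> F'" and B: "B \<in> F'" and eq: "?\<Phi> A = ?\<Phi> B" for A B
      proof
        fix x assume x: "x \<in> A"
        have xX0: "x \<in> X0" using x A F' by (auto simp: X0_def)
        show "x \<in> B"
        proof (cases "x \<in> Z")
          case True
          then have "x \<in> Z'" using big A x by (auto simp: Z'_def)
          then have "tclass F X x \<in> tclass F X ` (B \<inter> Z')" using eq x by blast
          then obtain y where y: "y \<in> B" "y \<in> Z'" "tclass F X x = tclass F X y" by auto
          then have "twin F x y" using tclass_eq_iff[of x X y F] \<open>x \<in> Z'\<close> Z'X by blast
          then show ?thesis using y(1) B F' by (auto simp: twin_def)
        next
          case False
          then show ?thesis using eq x xX0 by blast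
        qed
      qed
      show "inj_on ?\<Phi> F'" by (rule inj_onI) (metis sub subset_antisym)
      show "?\<Phi> ` F' \<subseteq> Pow (tclass F X ` Z') \<times> (\<lambda>A. A \<inter> (X0 - Z)) ` F" using F' by auto
      show "finite (Pow (tclass F X ` Z') \<times> (\<lambda>A. A \<inter> (X0 - Z)) ` F)" using finZ' finT by auto
    qed
    also have "\<dots> = 2 ^ c * ?t" using finZ' by (simp add: c_def card_cartesian_product card_Pow)
    finally have "card F' ^ (8 * l) \<le> (2 ^ c * ?t) ^ (8 * l)" by (rule power_mono) simp
    also have "\<dots> = 2 ^ (8 * l * c) * ?t ^ (8 * l)" by (simp add: power_mult_distrib mult.commute flip: power_mult)
    also have "\<dots> \<le> 2 ^ (8 * l * c) * 2 ^ card X"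
    proof (rule mult_le_mono2)
      have "(2::nat) ^ card X0 \<le> 2 ^ card X" using X X0 by (intro power_increasing card_mono) auto
      then show "?t ^ (8 * l) \<le> 2 ^ card X" using traces by linarith
    qed
    also have "\<dots> = 2 ^ (8 * l * c + card X)" by (simp add: power_add)
    finally have main: "card F' ^ (8 * l) \<le> 2 ^ (8 * l * c + card X)" .
    \<comment> \<open>On so few points no large class fits, hence \<open>c = 0\<close>, and two
      members would force \<open>8 * l <= card X\<close>.\<close>
    have "card F' \<le> 1" if n: "card X < 2 * l"
    proof (rule ccontr)
      assume "\<not> card F' \<le> 1"
      then have ge: "(2::nat) ^ (8 * l) \<le> card F' ^ (8 * l)" by (intro power_mono) auto
      have "c = 0"
      proof (rule ccontr)
        assume "c \<noteq> 0"
        then have "2 * l * 1 \<le> 2 * l * c" by (intro mult_le_mono2) auto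
        then show False using c n by linarith
      qed
      with main have "card F' ^ (8 * l) \<le> 2 ^ card X" by simp
      from order_trans[OF ge this] have "8 * l \<le> card X" by simp
      then show False using n by simp
    qed
    moreover have "8 * l * c = 4 * (2 * l * c)" by simp
    with c have "8 * l * c + card X \<le> 5 * card X" by linarith
    then have "(2::nat) ^ (8 * l * c + card X) \<le> 2 ^ (5 * card X)"
      by (intro power_increasing) auto
    ultimately show ?thesis using order_trans[OF main] by blast
  qed
  then show ?thesis using Z unfolding X0_def by blast
qed

section \<open>Families all of whose small intersections are divisible\<close>

text \<open>The degree reached when \<open>1 - (1 - g^l)^l\<close> is applied to a \<open>g\<close>
  of degree \<open>iso_degree l\<close>.\<close>

definition core_degree :: "nat \<Rightarrow> nat" where
  "core_degree l = iso_degree l * l * l"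

lemma two_times_le_if_dvd:
  fixes l m :: nat
  assumes "l dvd m" "m \<noteq> l" "m \<noteq> 0"
  shows "2 * l \<le> m"
proof -
  obtain q where q: "m = l * q" using assms(1) by blast
  then have "2 \<le> q" using assms(2,3) by (cases q; cases "q - 1") auto
  then show ?thesis using q by (simp add: mult.commute)
qed

text \<open>Choosing one preimage per member keeps the number of intersected sets at most
  \<open>j\<close>.\<close>

lemma meets_image:
  assumes f: "\<And>G. G \<subseteq> F \<Longrightarrow> G \<noteq> {} \<Longrightarrow> \<Inter>(f ` G) = h (\<Inter>G)" and "A \<in> meets (f ` F) j"
  shows "\<exists>B\<in>meets F j. A = h B"
proof -
  obtain G where G: "A = \<Inter>G" "G \<subseteq> f ` F" "G \<noteq> {}" "finite G" "card G \<le> j"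
    using assms(2) by (auto simp: meets_def)
  obtain U where U: "U \<subseteq> F" "inj_on f U" "G = f ` U" using G(2) subset_image_inj[of G f F] by blast
  have "finite U" "card U \<le> j" using U G by (auto simp: finite_image_iff card_image)
  then have "\<Inter>U \<in> meets F j" using U G unfolding meets_def by (intro CollectI exI[of _ U]) auto
  moreover have "A = h (\<Inter>U)" using f[of U] U G by auto
  ultimately show ?thesis by blast
qed

lemma meets_subset:
  assumes "G \<in> meets F j" "F \<subseteq> Pow X"
  shows "G \<subseteq> X"
proof -
  obtain H where "G = \<Inter>H" "H \<subseteq> F" "H \<noteq> {}" using assms(1) by (auto simp: meets_def)
  moreover from this obtain A where "A \<in> H" by blast
  ultimately show ?thesis using assms(2) by blast
qed

lemma meets_twin:
  assumes "G \<in> meets F j" "twin F x y"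
  shows "x \<in> G \<longleftrightarrow> y \<in> G"
  using assms by (auto simp: meets_def twin_def)

text \<open>Removing a twin class of size \<open>l\<close> costs a factor 2 and lowers
  \<open>card X div l\<close> by one, which drives the induction. When there is none, every isolated
  class has a size divisible by \<open>l\<close> and hence at least \<open>2 * l\<close>, and the
  preceding bound applies to all of \<open>F\<close>.\<close>

lemma divisible_meets_bound:
  assumes l: "l > 0" and "finite X" and "F \<subseteq> Pow X"
    and "\<And>G. G \<in> meets F (core_degree l) \<Longrightarrow> l dvd card G"
  shows "card F \<le> 2 ^ (card X div l)"
  using assms(2-)
proof (induction "card X" arbitrary: X F rule: less_induct)
  case less
  note X = less.prems(1) and F = less.prems(2) and dvd = less.prems(3)
  have finF: "finite F" using F X finite_subset by blast
  show ?case
  proof (cases "\<exists>x\<in>X. card (tclass F X x) = l")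
    case True
    then obtain x where x: "x \<in> X" "card (tclass F X x) = l" by auto
    define D where "D = tclass F X x"
    have D: "D \<subseteq> X" "x \<in> D" "card D = l" using x twin_refl by (auto simp: D_def tclass_def)
    have twinD: "y \<in> D \<Longrightarrow> twin F x y" for y by (simp add: D_def tclass_def)
    let ?f = "\<lambda>A. A - D"
    have cX: "card (X - D) = card X - l" using D X finite_subset by (metis card_Diff_subset)
    have le: "l \<le> card X" using D X card_mono by metis
    have "card (?f ` F) \<le> 2 ^ (card (X - D) div l)"
    proof (rule less.hyps)
      show "card (X - D) < card X" using cX le l by simp
      show "finite (X - D)" using X by simp
      show "?f ` F \<subseteq> Pow (X - D)" using F by auto
      fix G assume "G \<in> meets (?f ` F) (core_degree l)"
      then obtain B where B: "B \<in> meets F (core_degree l)" "G = B - D"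
        using meets_image[of F ?f ?f G "core_degree l"] by auto
      \<comment> \<open>An intersection of members contains all of \<open>D\<close> or none of it,
        so deleting \<open>D\<close> preserves divisibility.\<close>
      have "B \<inter> D = {} \<or> B \<inter> D = D" using meets_twin[OF B(1) twinD] by blast
      then have "l dvd card (B \<inter> D)" using D(3) by auto
      moreover have "finite B" using meets_subset[OF B(1) F] X finite_subset by blast
      then have "card B = card (B - D) + card (B \<inter> D)" by (metis add.commute card_Int_Diff)
      ultimately show "l dvd card G" using dvd[OF B(1)] B(2) by (simp add: dvd_add_left_iff)
    qed
    moreover have "card F \<le> 2 * card (?f ` F)"
    proof -
      have "card F \<le> card (?f ` F \<times> (UNIV :: bool set))"
      proof (rule card_inj_on_le[of "\<lambda>A. (A - D, x \<in> A)"])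
        show "inj_on (\<lambda>A. (A - D, x \<in> A)) F"
        proof (rule inj_onI)
          fix A B assume A: "A \<in> F" and B: "B \<in> F" and eq: "(A - D, x \<in> A) = (B - D, x \<in> B)"
          have "y \<in> A \<longleftrightarrow> y \<in> B" if "y \<in> D" for y
            using twinD[OF that] A B eq by (auto simp: twin_def)
          then show "A = B" using eq by blast
        qed
      qed (use finF in auto)
      then show ?thesis using finF by (simp add: card_cartesian_product mult.commute)
    qed
    moreover have "card X div l = Suc (card (X - D) div l)"
      using le l cX by (simp add: le_div_geq)
    ultimately show ?thesis by simp
  next
    case False
    obtain Z where Z: "Z \<subseteq> \<Union>F" "\<forall>x\<in>Z. isolated F (\<Union>F) (iso_degree l) l x"
      and bound: "\<And>F'. F' \<subseteq> F \<Longrightarrow> (\<forall>A\<in>F'. \<forall>x\<in>A \<inter> Z. 2 * l \<le> card (tclass F X x)) \<Longrightarrow>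
         card F' ^ (8 * l) \<le> 2 ^ (5 * card X) \<and> (card X < 2 * l \<longrightarrow> card F' \<le> 1)"
      using isolated_family_bound[OF l X F] by blast
    have UX: "\<Union>F \<subseteq> X" using F by auto
    have "2 * l \<le> card (tclass F X x)" if x: "x \<in> Z" for x
    proof -
      have xU: "x \<in> \<Union>F" using x Z by auto
      have "l dvd card {y \<in> \<Union>F. twin F x y}"
      proof (rule isolated_dvd[OF _ l _ xU order_refl])
        show "isolated F (\<Union>F) (iso_degree l) l x" using Z x by auto
        show "finite (\<Union>F)" using UX X finite_subset by blast
        fix G assume G: "G \<in> meets F (iso_degree l * l * l)"
        then have "G \<subseteq> \<Union>F" by (auto simp: meets_def)
        then show "l dvd card (G \<inter> \<Union>F)" using dvd[of G] G by (simp add: core_degree_def Int_absorb2)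
      qed auto
      then have "l dvd card (tclass F X x)" using tclass_Union[OF F xU] by (simp add: tclass_def)
      moreover have "card (tclass F X x) \<noteq> l" using False xU UX by auto
      moreover have "card (tclass F X x) \<noteq> 0"
        using X subsetD[OF UX xU] twin_refl[of F x] by (auto simp: tclass_def card_eq_0_iff)
      ultimately show ?thesis by (rule two_times_le_if_dvd)
    qed
    then have b: "card F ^ (8 * l) \<le> 2 ^ (5 * card X)" "card X < 2 * l \<longrightarrow> card F \<le> 1"
      using bound[of F] by auto
    show ?thesis
    proof (cases "card X < 2 * l")
      case True
      then show ?thesis using b(2) by (meson le_trans one_le_numeral one_le_power)
    next
      case ge: False
      \<comment> \<open>The exponent \<open>5 * card X\<close> is at most
        \<open>l * (5 * a + 5)\<close>, and \<open>5 * a + 5 <= 8 * a\<close> because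
        \<open>a >= 2\<close>.\<close>
      define a where "a = card X div l"
      have "2 \<le> a" unfolding a_def using ge l by (simp add: less_eq_div_iff_mult_less_eq)
      have "card X < l * (a + 1)" unfolding a_def using l by (metis Suc_eq_plus1 dividend_less_times_div mult_Suc_right add.commute)
      then have "5 * card X \<le> 5 * (l * (a + 1))" by simp
      also have "\<dots> = l * (5 * a + 5)" by (simp add: algebra_simps)
      also have "\<dots> \<le> l * (8 * a)" using \<open>2 \<le> a\<close> by (intro mult_le_mono2) simp
      finally have "(2::nat) ^ (5 * card X) \<le> 2 ^ (a * (8 * l))"
        by (intro power_increasing) (auto simp: mult_ac)
      then have "card F ^ (8 * l) \<le> (2 ^ a) ^ (8 * l)" using b(1) by (simp add: power_mult)
      then show ?thesis unfolding a_def using l by (subst (asm) power_mono_iff) auto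
    qed
  qed
qed

section \<open>Control of k distinct members only\<close>

text \<open>Padding shows that an intersection of \<open>q\<close> members through \<open>x\<close>
  lies in fewer than \<open>k\<close> members. So a given set arises from at most \<open>2^k\<close>
  choices of the \<open>q\<close> members, and there are at most \<open>2 ^ card X\<close>
  sets.\<close>

lemma bad_class_degree:
  assumes l: "l > 0" and X: "finite X" and F: "F \<subseteq> Pow X" and q: "q > 0"
    and k: "k \<ge> core_degree l + q"
    and kw: "\<And>G. G \<subseteq> F \<Longrightarrow> card G = k \<Longrightarrow> l dvd card (\<Inter>G)"
    and x: "x \<in> \<Union>F" and iso: "isolated F (\<Union>F) (iso_degree l) l x"
    and bad: "\<not> l dvd card (tclass F X x)"
  shows "card {A \<in> F. x \<in> A} choose q \<le> 2 ^ (card X + k)"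
proof -
  define L where "L = {A \<in> F. x \<in> A}"
  define S where "S = {H. H \<subseteq> L \<and> card H = q}"
  have finF: "finite F" using F X finite_subset by blast
  have finL: "finite L" using finF by (simp add: L_def)
  have few: "card {A \<in> F. \<Inter>H \<subseteq> A} < k" if H: "H \<in> S" for H
  proof (rule ccontr)
    let ?P = "{A \<in> F. \<Inter>H \<subseteq> A}"
    \<comment> \<open>Members of \<open>?P\<close> pad \<open>D \<union> H\<close> to \<open>k\<close> sets without changing the intersection.\<close>
    assume "\<not> card ?P < k"
    then have P: "k \<le> card ?P" by simp
    have HL: "H \<subseteq> L" "card H = q" using H by (auto simp: S_def)
    then have HF: "H \<subseteq> F" by (auto simp: L_def)
    have "H \<noteq> {}" using HL q by auto
    have xH: "x \<in> \<Inter>H" using HL by (auto simp: L_def)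
    have "l dvd card {y \<in> \<Union>F. twin F x y}"
    proof (rule isolated_dvd[OF iso l _ x])
      show "finite (\<Union>F)" using F X by (meson Sup_le_iff finite_subset PowD subsetD)
      show "\<Inter>H \<subseteq> \<Union>F" using \<open>H \<noteq> {}\<close> HF by blast
      show "{y \<in> \<Union>F. twin F x y} \<subseteq> \<Inter>H" using xH HF by (auto simp: twin_def)
      fix G assume "G \<in> meets F (iso_degree l * l * l)"
      then obtain D where D: "G = \<Inter>D" "D \<subseteq> F" "D \<noteq> {}" "finite D" "card D \<le> core_degree l"
        by (auto simp: meets_def core_degree_def)
      have "card (D \<union> H) \<le> k" using card_Un_le[of D H] D HL k by linarith
      moreover have "k \<le> card (D \<union> ?P)"
        by (rule order_trans[OF P card_mono]) (use finF D in auto)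
      moreover have "D \<union> H \<subseteq> D \<union> ?P" using HF by auto
      moreover have "finite (D \<union> ?P)" using D finF by auto
      ultimately obtain E where E: "D \<union> H \<subseteq> E" "E \<subseteq> D \<union> ?P" "card E = k"
        using exists_subset_between[of "D \<union> H" k "D \<union> ?P"] by blast
      have "\<Inter>E = G \<inter> \<Inter>H"
      proof (rule subset_antisym)
        show "\<Inter>E \<subseteq> G \<inter> \<Inter>H" using E(1) unfolding D(1) by auto
        show "G \<inter> \<Inter>H \<subseteq> \<Inter>E"
        proof (rule Inter_greatest)
          fix A assume "A \<in> E"
          then have "A \<in> D \<or> \<Inter>H \<subseteq> A" using E(2) by auto
          then show "G \<inter> \<Inter>H \<subseteq> A" unfolding D(1) by blast
        qed
      qed
      moreover have "E \<subseteq> F" using E D by auto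
      ultimately show "l dvd card (G \<inter> \<Inter>H)" using kw[of E] E by simp
    qed
    then show False using bad tclass_Union[OF F x] by (simp add: tclass_def)
  qed
  have "card S \<le> card (Inter ` S) * 2 ^ k"
  proof (rule card_le_image_fibres)
    show "finite S" using finL by (simp add: S_def)
    fix H assume H: "H \<in> S"
    let ?P = "{A \<in> F. \<Inter>H \<subseteq> A}"
    \<comment> \<open>All \<open>H'\<close> with this intersection consist of members containing
      it.\<close>
    have "card {H' \<in> S. \<Inter>H' = \<Inter>H} \<le> card (Pow ?P)"
      by (rule card_mono) (use finF in \<open>auto simp: S_def L_def\<close>)
    also have "\<dots> \<le> 2 ^ k" using few[OF H] finF by (simp add: card_Pow)
    finally show "card {H' \<in> S. \<Inter>H' = \<Inter>H} \<le> 2 ^ k" .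
  qed
  also have "card (Inter ` S) \<le> card (Pow X)"
  proof (rule card_mono)
    have "\<Inter>H \<subseteq> X" if "H \<in> S" for H
    proof -
      have "H \<noteq> {}" "H \<subseteq> F" using that q by (auto simp: S_def L_def)
      then show ?thesis using F by blast
    qed
    then show "Inter ` S \<subseteq> Pow X" by auto
  qed (use X in simp)
  finally have "card S \<le> 2 ^ card X * 2 ^ k" using X by (simp add: card_Pow)
  then show ?thesis using n_subsets[OF finL, of q] by (simp add: S_def L_def power_add)
qed

text \<open>Follows from \<open>(m/q)^q <= m choose q\<close> by taking q-th roots.\<close>

lemma le_if_choose_le:
  assumes "m choose q \<le> 2 ^ N" "q > 0"
  shows "real m \<le> real q * 2 powr (real N / real q)"
proof (cases "m < q")
  case True
  have "real q * 1 \<le> real q * 2 powr (real N / real q)"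
    by (intro mult_left_mono ge_one_powr_ge_zero) auto
  then show ?thesis using True by linarith
next
  case False
  then have "(real m / real q) ^ q \<le> real (m choose q)"
    using binomial_ge_n_over_k_pow_k[of q m] by simp
  also have "\<dots> \<le> 2 ^ N" using assms(1) by (metis of_nat_le_iff of_nat_numeral of_nat_power)
  also have "\<dots> = (2 powr (real N / real q)) ^ q"
    using assms(2) by (simp add: powr_realpow[symmetric] powr_powr)
  finally have "real m / real q \<le> 2 powr (real N / real q)"
    using assms(2) power_mono_iff[of "real m / real q" "2 powr (real N / real q)" q] by simp
  then show ?thesis using assms(2) by (simp add: field_simps)
qed

text \<open>The first summand counts members through isolated points whose class size is not
  divisible by \<open>l\<close>, using the degree bound with \<open>q = 8 * l\<close> at each point.
  The remaining members see only isolated classes of size at least \<open>2 * l\<close>, as size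
  \<open>l\<close> is excluded; they give the second summand.\<close>

lemma k_wise_sparse_bound:
  assumes l: "l > 0" and X: "finite X" and F: "F \<subseteq> Pow X"
    and k: "k \<ge> core_degree l + 8 * l"
    and kw: "\<And>G. G \<subseteq> F \<Longrightarrow> card G = k \<Longrightarrow> l dvd card (\<Inter>G)"
    and no: "\<And>x. x \<in> X \<Longrightarrow> card (tclass F X x) \<noteq> l"
  shows "real (card F) \<le> real (card X) * (real (8 * l) * 2 powr (real (card X + k) / real (8 * l)))
    + 2 powr (real (5 * card X) / real (8 * l))"
proof -
  have finF: "finite F" using F X finite_subset by blast
  have UX: "\<Union>F \<subseteq> X" using F by auto
  obtain Z where Z: "Z \<subseteq> \<Union>F" "\<forall>x\<in>Z. isolated F (\<Union>F) (iso_degree l) l x"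
    and bound: "\<And>F'. F' \<subseteq> F \<Longrightarrow> (\<forall>A\<in>F'. \<forall>x\<in>A \<inter> Z. 2 * l \<le> card (tclass F X x)) \<Longrightarrow>
       card F' ^ (8 * l) \<le> 2 ^ (5 * card X) \<and> (card X < 2 * l \<longrightarrow> card F' \<le> 1)"
    using isolated_family_bound[OF l X F] by blast
  define Zb where "Zb = {x \<in> Z. \<not> l dvd card (tclass F X x)}"
  define F' where "F' = {A \<in> F. A \<inter> Zb = {}}"
  define m where "m = real (8 * l) * 2 powr (real (card X + k) / real (8 * l))"
  have ZbX: "Zb \<subseteq> X" using Z UX by (auto simp: Zb_def)
  then have finZb: "finite Zb" using X finite_subset by blast
  have deg: "real (card {A \<in> F. x \<in> A}) \<le> m" if x: "x \<in> Zb" for x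
    unfolding m_def
    by (intro le_if_choose_le bad_class_degree[OF l X F _ k kw]) (use x Z l in \<open>auto simp: Zb_def\<close>)
  have "real (card (\<Union>x\<in>Zb. {A \<in> F. x \<in> A})) \<le> real (\<Sum>x\<in>Zb. card {A \<in> F. x \<in> A})"
    using card_UN_le[OF finZb, of "\<lambda>x. {A \<in> F. x \<in> A}"] by (simp only: of_nat_le_iff)
  also have "\<dots> \<le> (\<Sum>x\<in>Zb. m)" unfolding of_nat_sum by (rule sum_mono) (rule deg)
  also have "\<dots> \<le> real (card X) * m"
    using card_mono[OF X ZbX] by (auto simp: m_def intro!: mult_right_mono)
  finally have b1: "real (card (\<Union>x\<in>Zb. {A \<in> F. x \<in> A})) \<le> real (card X) * m" .
  have "2 * l \<le> card (tclass F X x)" if "A \<in> F'" "x \<in> A \<inter> Z" for A x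
  proof (rule two_times_le_if_dvd)
    have xX: "x \<in> X" using that Z UX by auto
    show "l dvd card (tclass F X x)" using that by (auto simp: F'_def Zb_def)
    show "card (tclass F X x) \<noteq> l" using no xX by blast
    show "card (tclass F X x) \<noteq> 0" using X xX twin_refl[of F x] by (auto simp: tclass_def card_eq_0_iff)
  qed
  then have "card F' ^ (8 * l) \<le> 2 ^ (5 * card X)" using bound[of F'] by (auto simp: F'_def)
  then have "real (card F') ^ (8 * l) \<le> 2 ^ (5 * card X)"
    by (metis of_nat_le_iff of_nat_numeral of_nat_power)
  also have "\<dots> = (2 powr (real (5 * card X) / real (8 * l))) ^ (8 * l)"
    using l by (simp add: powr_realpow[symmetric] powr_powr)
  finally have b2: "real (card F') \<le> 2 powr (real (5 * card X) / real (8 * l))"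
    using l power_mono_iff[of "real (card F')" "2 powr (real (5 * card X) / real (8 * l))" "8 * l"] by simp
  have "F = (\<Union>x\<in>Zb. {A \<in> F. x \<in> A}) \<union> F'" by (auto simp: F'_def)
  then have "card F \<le> card (\<Union>x\<in>Zb. {A \<in> F. x \<in> A}) + card F'" by (metis card_Un_le)
  then show ?thesis using b1 b2 unfolding m_def by linarith
qed

text \<open>In terms of \<open>t = n / (8 l)\<close> the left side is
  \<open>K t 2^t + 2^(5t)\<close>, to be compared with \<open>2^(8t) = 2^(n/l)\<close>. Rounding
  \<open>n/l\<close> down loses at most a factor 2, so the limit comparison is made with the
  constant 1/4.\<close>

lemma sparse_bound_eventually:
  assumes l: "l > 0"
  shows "\<exists>C. \<forall>n\<ge>C. real n * (real (8 * l) * 2 powr (real (n + k) / real (8 * l)))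
    + 2 powr (real (5 * n) / real (8 * l)) \<le> 2 ^ (n div l) / 2"
proof -
  define K where "K = real (8 * l) * real (8 * l) * 2 powr (real k / real (8 * l))"
  have K: "K > 0" using l by (simp add: K_def)
  have "eventually (\<lambda>t. K * t * 2 powr t + 2 powr (5 * t) \<le> 2 powr (8 * t) / 4) at_top"
    using K by real_asymp
  moreover have "filterlim (\<lambda>n. real n / real (8 * l)) at_top sequentially"
    using l by real_asymp
  ultimately have "eventually (\<lambda>n. K * (real n / real (8 * l)) * 2 powr (real n / real (8 * l)) +
      2 powr (5 * (real n / real (8 * l))) \<le> 2 powr (8 * (real n / real (8 * l))) / 4) sequentially"
    by (rule eventually_compose_filterlim)
  then obtain C where C: "\<And>n. n \<ge> C \<Longrightarrow> K * (real n / real (8 * l)) * 2 powr (real n / real (8 * l)) +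
      2 powr (5 * (real n / real (8 * l))) \<le> 2 powr (8 * (real n / real (8 * l))) / 4"
    by (auto simp: eventually_sequentially)
  have "real n * (real (8 * l) * 2 powr (real (n + k) / real (8 * l)))
    + 2 powr (real (5 * n) / real (8 * l)) \<le> 2 ^ (n div l) / 2" if n: "n \<ge> C" for n
  proof -
    have "real n * (real (8 * l) * 2 powr (real (n + k) / real (8 * l))) =
      K * (real n / real (8 * l)) * 2 powr (real n / real (8 * l))"
      using l by (simp add: K_def add_divide_distrib powr_add)
    moreover have "2 powr (real (5 * n) / real (8 * l)) = 2 powr (5 * (real n / real (8 * l)))" by simp
    moreover have "2 powr (8 * (real n / real (8 * l))) / 4 \<le> 2 ^ (n div l) / (2::real)"
    proof -
      have "n \<le> l * (n div l + 1)" using dividend_less_times_div[OF l, of n] by simp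
      then have "real n \<le> real l * (real (n div l) + 1)" by (metis of_nat_1 of_nat_add of_nat_le_iff of_nat_mult)
      then have "real n / real l \<le> real (n div l) + 1" using l by (simp add: field_simps)
      then have "2 powr (real n / real l) \<le> 2 powr (real (n div l) + 1)" by simp
      also have "\<dots> = 2 ^ (n div l) * 2" by (simp add: powr_add powr_realpow)
      finally show ?thesis using l by simp
    qed
    ultimately show ?thesis using C[OF n] by linarith
  qed
  then show ?thesis by blast
qed

section \<open>Splitting off the classes of size l; heavy and light traces\<close>

lemma card_twin_closed:
  assumes X: "finite X" and S: "S \<subseteq> X"
    and cl: "\<And>x. x \<in> S \<Longrightarrow> card (tclass F X x) = l \<and> tclass F X x \<subseteq> S"
  shows "card S = l * card (tclass F X ` S)"
proof -
  have "S = \<Union>(tclass F X ` S)" using cl S twin_refl[of F] unfolding tclass_def by blast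
  then have "card S = card (\<Union>(tclass F X ` S))" by simp
  also have "\<dots> = (\<Sum>D\<in>tclass F X ` S. card D)"
  proof (rule card_Union_disjoint)
    show "pairwise disjnt (tclass F X ` S)"
      using tclass_disjoint[of F X] unfolding pairwise_def disjnt_def by blast
    show "finite D" if "D \<in> tclass F X ` S" for D
      using that X by (auto simp: tclass_def)
  qed
  also have "\<dots> = (\<Sum>D\<in>tclass F X ` S. l)" by (rule sum.cong) (use cl in auto)
  finally show ?thesis by simp
qed

text \<open>A member of \<open>F\<close> is its trace on \<open>Y\<close> together with a choice
  among the \<open>a\<close> classes of size \<open>l\<close>, so a trace has at most
  \<open>2^a\<close> preimages. A large \<open>Y\<close> falls under the sparse bound; a
  \<open>Y\<close> with fewer than \<open>C\<close> points has boundedly many traces.\<close>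

lemma k_wise_bound:
  assumes l: "l > 0" and k: "k = core_degree l + 8 * l"
    and C: "\<And>n. n \<ge> C \<Longrightarrow> real n * (real (8 * l) * 2 powr (real (n + k) / real (8 * l)))
      + 2 powr (real (5 * n) / real (8 * l)) \<le> 2 ^ (n div l) / 2"
    and X: "finite X" and F: "F \<subseteq> Pow X"
    and kw: "\<And>G. G \<subseteq> F \<Longrightarrow> card G = k \<Longrightarrow> l dvd card (\<Inter>G)"
  shows "card F \<le> 2 ^ (card X div l) + k * 2 ^ C \<and>
    (l dvd card X \<and> card X \<ge> l * (k * 2 ^ C) + C \<longrightarrow> card F \<le> 2 ^ (card X div l))"
proof -
  have finF: "finite F" using F X finite_subset by blast
  have k2: "k \<ge> 2" using k l by simp
  define T where "T = {x \<in> X. card (tclass F X x) = l}"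
  define Y where "Y = X - T"
  define a where "a = card (tclass F X ` T)"
  define b where "b = card Y div l"
  let ?f = "\<lambda>A. A \<inter> Y"
  define F' where "F' = ?f ` F"
  have TX: "T \<subseteq> X" and YX: "Y \<subseteq> X" by (auto simp: T_def Y_def)
  have fin: "finite T" "finite Y" using TX YX X finite_subset by blast+
  have finF': "finite F'" using finF by (simp add: F'_def)
  have F'Y: "F' \<subseteq> Pow Y" by (auto simp: F'_def)
  have tT: "y \<in> T" if "x \<in> T" "y \<in> X" "twin F x y" for x y
    using that tclass_eq_iff[of x X y F] by (auto simp: T_def)
  have T_closed: "card (tclass F X x) = l \<and> tclass F X x \<subseteq> T" if "x \<in> T" for x
    using that tT[OF that] by (auto simp: tclass_def T_def)
  have cT: "card T = l * a"
    unfolding a_def by (rule card_twin_closed[OF X TX T_closed])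
  have cX: "card X = l * a + card Y"
    using card_Un_disjoint[OF fin] TX by (simp add: Y_def cT Un_absorb1)
  have divX: "card X div l = a + b" using l by (simp add: cX b_def)
  \<comment> \<open>An intersection meets \<open>T\<close> in a union of classes of size
    \<open>l\<close>, so only its part in \<open>Y\<close> matters. The \<open>k\<close> members are
    distinct, but their traces may coincide.\<close>
  have lift_dvd: "l dvd card (\<Inter>(?f ` K))" if K: "K \<subseteq> F" "card K = k" for K
  proof -
    have "K \<noteq> {}" using K k2 by auto
    define B where "B = \<Inter>K"
    have BX: "B \<subseteq> X" using \<open>K \<noteq> {}\<close> K F unfolding B_def by blast
    have twB: "x \<in> B \<longleftrightarrow> y \<in> B" if "twin F x y" for x y
      using that K by (auto simp: B_def twin_def)
    have "card (B \<inter> T) = l * card (tclass F X ` (B \<inter> T))"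
    proof (rule card_twin_closed[OF X])
      fix x assume "x \<in> B \<inter> T"
      then show "card (tclass F X x) = l \<and> tclass F X x \<subseteq> B \<inter> T"
        using T_closed[of x] twB[of x] by (auto simp: tclass_def)
    qed (use TX in auto)
    moreover have "card B = card (B \<inter> T) + card (B \<inter> Y)"
    proof -
      have "B = (B \<inter> T) \<union> (B \<inter> Y)" using BX by (auto simp: Y_def)
      moreover have "(B \<inter> T) \<inter> (B \<inter> Y) = {}" by (auto simp: Y_def)
      ultimately show ?thesis using card_Un_disjoint[of "B \<inter> T" "B \<inter> Y"] fin by simp
    qed
    moreover have "l dvd card B" unfolding B_def by (rule kw[OF K])
    ultimately have "l dvd card (B \<inter> Y)" by (simp add: dvd_add_right_iff)
    moreover have "\<Inter>(?f ` K) = B \<inter> Y" using \<open>K \<noteq> {}\<close> by (auto simp: B_def)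
    ultimately show ?thesis by simp
  qed
  have fibre: "card {A \<in> F. ?f A = G} \<le> 2 ^ a" for G
  proof -
    have "card {A \<in> F. ?f A = G} \<le> card (Pow (tclass F X ` T))"
    proof (rule card_inj_on_le[of "\<lambda>A. tclass F X ` (A \<inter> T)"])
      have sub: "A \<subseteq> B" if A: "A \<in> {A \<in> F. ?f A = G}" and B: "B \<in> {A \<in> F. ?f A = G}"
        and eq: "tclass F X ` (A \<inter> T) = tclass F X ` (B \<inter> T)" for A B
      proof
        fix x assume x: "x \<in> A"
        then have xX: "x \<in> X" using A F by auto
        show "x \<in> B"
        proof (cases "x \<in> T")
          case True
          then have "tclass F X x \<in> tclass F X ` (B \<inter> T)" using eq x by blast
          then obtain y where y: "y \<in> B" "y \<in> T" "tclass F X x = tclass F X y" by auto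
          then have "twin F x y" using tclass_eq_iff[of x X y F] xX TX by blast
          then show ?thesis using y(1) B by (auto simp: twin_def)
        next
          case False
          then have "x \<in> ?f A" using x xX by (auto simp: Y_def)
          then show ?thesis using A B by auto
        qed
      qed
      show "inj_on (\<lambda>A. tclass F X ` (A \<inter> T)) {A \<in> F. ?f A = G}"
      proof (rule inj_onI)
        fix A B assume "A \<in> {A \<in> F. ?f A = G}" "B \<in> {A \<in> F. ?f A = G}"
          and "tclass F X ` (A \<inter> T) = tclass F X ` (B \<inter> T)"
        then show "A = B" using sub[of A B] sub[of B A] by (intro subset_antisym) simp_all
      qed
    qed (use fin in auto)
    then show ?thesis using fin by (simp add: card_Pow a_def)
  qed
  have F_le: "card F \<le> card F' * 2 ^ a"
    unfolding F'_def by (rule card_le_image_fibres[OF finF fibre])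
  show ?thesis
  proof (cases "card Y \<ge> C")
    case True
    have twF': "twin F' x y \<longleftrightarrow> twin F x y" if "x \<in> Y" "y \<in> Y" for x y
      using that by (auto simp: twin_def F'_def)
    \<comment> \<open>Points of \<open>Y\<close> have no twins in \<open>T\<close>, so passing to
      traces creates no new class of size \<open>l\<close>.\<close>
    have tcl: "tclass F' Y x = tclass F X x" if x: "x \<in> Y" for x
    proof -
      have "y \<in> Y" if "y \<in> X" "twin F x y" for y
        using tT[of y x] that x twin_sym[of F x y] by (auto simp: Y_def)
      then show ?thesis using twF'[OF x] YX by (auto simp: tclass_def)
    qed
    have "real (card F') \<le> real (card Y) * (real (8 * l) * 2 powr (real (card Y + k) / real (8 * l)))
      + 2 powr (real (5 * card Y) / real (8 * l))"
    proof (rule k_wise_sparse_bound[OF l fin(2) F'Y])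
      show "k \<ge> core_degree l + 8 * l" using k by simp
      show "card (tclass F' Y x) \<noteq> l" if "x \<in> Y" for x
        using that tcl[OF that] by (auto simp: Y_def T_def)
      fix G assume G: "G \<subseteq> F'" "card G = k"
      obtain U where U: "U \<subseteq> F" "inj_on ?f U" "G = ?f ` U"
        using G(1) subset_image_inj[of G ?f F] unfolding F'_def by blast
      then have "card U = k" using G(2) card_image by metis
      then show "l dvd card (\<Inter>G)" using lift_dvd[OF U(1)] U(3) by simp
    qed
    also have "\<dots> \<le> 2 ^ b / 2" unfolding b_def by (rule C[OF True])
    finally have "real (2 * card F') \<le> real (2 ^ b)" by simp
    then have "2 * card F' \<le> 2 ^ b" by (simp only: of_nat_le_iff)
    then have "card F' * 2 ^ a \<le> 2 ^ b * 2 ^ a" by (intro mult_le_mono1) simp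
    from order_trans[OF F_le this] have "card F \<le> 2 ^ (card X div l)"
      by (simp add: divX power_add mult.commute)
    then show ?thesis by simp
  next
    case False
    define H where "H = {G \<in> F'. k \<le> card {A \<in> F. ?f A = G}}"
    \<comment> \<open>One preimage per trace in \<open>G\<close> is padded to \<open>k\<close>
      members by further preimages of traces in \<open>G\<close>; the heavy trace \<open>G0\<close>
      alone supplies enough, and the intersection of the traces is unchanged.\<close>
    have heavy_dvd: "l dvd card (\<Inter>G)" if G: "G \<subseteq> F'" "card G \<le> k" "G0 \<in> G" "G0 \<in> H" for G G0
    proof -
      obtain U where U: "U \<subseteq> F" "inj_on ?f U" "G = ?f ` U"
        using G(1) subset_image_inj[of G ?f F] unfolding F'_def by blast
      let ?P = "{A \<in> F. ?f A \<in> G}"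
      have "card U \<le> k" using U G(2) card_image by metis
      moreover have "k \<le> card ?P"
      proof -
        have "k \<le> card {A \<in> F. ?f A = G0}" using G(4) by (simp add: H_def)
        also have "\<dots> \<le> card ?P" by (rule card_mono) (use finF G(3) in auto)
        finally show ?thesis .
      qed
      moreover have "U \<subseteq> ?P" using U by auto
      ultimately obtain K where K: "U \<subseteq> K" "K \<subseteq> ?P" "card K = k"
        using exists_subset_between[of U k ?P] finF by auto
      have "?f ` K = G" using K(1,2) U(3) by auto
      moreover have "K \<subseteq> F" using K(2) by auto
      ultimately show ?thesis using lift_dvd[of K] K(3) by simp
    qed
    have meets_heavy: "l dvd card (\<Inter>G)" if G: "G \<subseteq> H" "G \<noteq> {}" "card G \<le> k" for G
    proof -
      obtain G0 where "G0 \<in> G" using G by blast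
      then show ?thesis using heavy_dvd[of G G0] G by (auto simp: H_def)
    qed
    have core: "card J \<le> 2 ^ b"
      if J: "J \<subseteq> Pow Y" and dv: "\<And>G. G \<subseteq> J \<Longrightarrow> G \<noteq> {} \<Longrightarrow> card G \<le> k \<Longrightarrow> l dvd card (\<Inter>G)" for J
      unfolding b_def
    proof (rule divisible_meets_bound[OF l fin(2) J])
      fix B assume "B \<in> meets J (core_degree l)"
      then obtain G where "B = \<Inter>G" "G \<subseteq> J" "G \<noteq> {}" "card G \<le> core_degree l" by (auto simp: meets_def)
      then show "l dvd card B" using dv[of G] k by auto
    qed
    have HF': "H \<subseteq> F'" by (auto simp: H_def)
    then have finH: "finite H" using finF' finite_subset by blast
    have HY: "H \<subseteq> Pow Y" using HF' F'Y by auto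
    have H_le: "card H \<le> 2 ^ b" by (rule core[OF HY meets_heavy])
    have split: "card F \<le> card H * 2 ^ a + card (F' - H) * k"
    proof -
      have "card F = (\<Sum>G\<in>F'. card {A \<in> F. ?f A = G})"
        using sum.image_gen[OF finF, of "\<lambda>A. 1::nat" ?f] by (simp add: F'_def)
      also have "\<dots> = (\<Sum>G\<in>H. card {A \<in> F. ?f A = G}) + (\<Sum>G\<in>F' - H. card {A \<in> F. ?f A = G})"
        using sum.subset_diff[OF HF' finF'] by (simp add: add.commute)
      also have "\<dots> \<le> (\<Sum>G\<in>H. 2 ^ a) + (\<Sum>G\<in>F' - H. k)"
        by (intro add_mono sum_mono fibre) (auto simp: H_def)
      finally show ?thesis by simp
    qed
    have "card (F' - H) \<le> card (Pow Y)" using F'Y fin by (intro card_mono) auto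
    also have "\<dots> \<le> 2 ^ C" using False fin by (simp add: card_Pow)
    finally have light: "card (F' - H) * k \<le> k * 2 ^ C" by simp
    have "card H * 2 ^ a \<le> 2 ^ b * 2 ^ a" by (rule mult_le_mono1[OF H_le])
    then have Ha: "card H * 2 ^ a \<le> 2 ^ (card X div l)" by (simp add: divX power_add mult.commute)
    have "card F \<le> 2 ^ (card X div l)" if lX: "l dvd card X" and big: "card X \<ge> l * (k * 2 ^ C) + C"
    proof (cases "F' - H = {}")
      case True
      then have "card (F' - H) * k = 0" by (simp only: card.empty mult_0)
      then show ?thesis using split Ha by linarith
    next
      case ex: False
      then obtain G1 where G1: "G1 \<in> F'" "G1 \<notin> H" by blast
      have lY: "l dvd card Y" using lX cX by (simp add: dvd_add_right_iff)
      \<comment> \<open>Since \<open>l\<close> divides \<open>card Y\<close>, the heavy family can be enlarged by \<open>Y\<close>, or by a light set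
        if it contains \<open>Y\<close> already.\<close>
      have "card H + 1 \<le> 2 ^ b"
      proof (cases "Y \<in> H")
        case True
        have "card (insert G1 H) \<le> 2 ^ b"
        proof (rule core)
          show "insert G1 H \<subseteq> Pow Y" using HY G1 F'Y by auto
          fix G assume G: "G \<subseteq> insert G1 H" "G \<noteq> {}" "card G \<le> k"
          show "l dvd card (\<Inter>G)"
          proof (cases "G \<inter> H = {}")
            case True
            then have "G = {G1}" using G by auto
            \<comment> \<open>The heavy set \<open>Y\<close> leaves \<open>G1\<close> unchanged
              under intersection, so even the light \<open>G1\<close> alone has size divisible by
              \<open>l\<close>.\<close>
            moreover have "l dvd card (\<Inter>{G1, Y})"
              by (rule heavy_dvd[of _ Y]) (use G1 \<open>Y \<in> H\<close> HF' k2 in \<open>auto simp: card_insert_if\<close>)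
            moreover have "\<Inter>{G1, Y} = G1" using G1 F'Y by auto
            ultimately show ?thesis by simp
          next
            case False
            then obtain G0 where "G0 \<in> G" "G0 \<in> H" by auto
            then show ?thesis using heavy_dvd[of G G0] G G1 HF' by auto
          qed
        qed
        then show ?thesis using G1 finH by simp
      next
        case False
        have "card (insert Y H) \<le> 2 ^ b"
        proof (rule core)
          show "insert Y H \<subseteq> Pow Y" using HY by auto
          fix G assume G: "G \<subseteq> insert Y H" "G \<noteq> {}" "card G \<le> k"
          show "l dvd card (\<Inter>G)"
          proof (cases "G - {Y} = {}")
            case True
            then have "G = {Y}" using G by auto
            then show ?thesis using lY by simp
          next
            case False
            then obtain G0 where G0: "G0 \<in> G - {Y}" by auto
            have GH: "G - {Y} \<subseteq> H" using G by auto
            have "finite G" using G(1) finH finite_subset by blast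
            then have "card (G - {Y}) \<le> k" using G(3) card_mono[of G "G - {Y}"] by auto
            then have "l dvd card (\<Inter>(G - {Y}))" using meets_heavy[OF GH False] by simp
            moreover have "\<Inter>(G - {Y}) = \<Inter>G"
            proof (rule subset_antisym)
              have "\<Inter>(G - {Y}) \<subseteq> Y" using G0 GH HY by blast
              then show "\<Inter>(G - {Y}) \<subseteq> \<Inter>G" by blast
            qed auto
            ultimately show ?thesis by simp
          qed
        qed
        then show ?thesis using \<open>Y \<notin> H\<close> finH by simp
      qed
      then have "(card H + 1) * 2 ^ a \<le> 2 ^ b * 2 ^ a" by (rule mult_le_mono1)
      then have "card H * 2 ^ a + 2 ^ a \<le> 2 ^ (card X div l)" by (simp add: divX power_add mult.commute)
      \<comment> \<open>One heavy trace fewer than the maximum saves \<open>2^a\<close> members. The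
        threshold on \<open>card X\<close>, with \<open>card Y < C\<close>, forces
        \<open>a >= k * 2 ^ C\<close>, so the saving covers all members with light traces.\<close>
      moreover have "k * 2 ^ C \<le> 2 ^ a"
      proof -
        have "l * (k * 2 ^ C) \<le> l * a" using big cX False by linarith
        then have "k * 2 ^ C \<le> a" using l by simp
        then show ?thesis using less_exp[of a] by linarith
      qed
      ultimately show ?thesis using split light by linarith
    qed
    then show ?thesis using split light Ha by linarith
  qed
qed

section \<open>Choice of the constants\<close>

theorem theorem1p1:
  fixes l :: nat
  assumes "l > 0"
  shows "\<exists>(k::nat) (c::real) (N::int). k > 0 \<and> c \<ge> 0 \<and>
    (\<forall>n::nat. n > 0 \<longrightarrow>
      (\<forall>F :: nat set set. F \<subseteq> Pow {1..n} \<longrightarrow>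
        (\<forall>G. G \<subseteq> F \<and> card G = k \<longrightarrow> l dvd card (\<Inter>G)) \<longrightarrow>
          real (card F) \<le> 2 ^ (n div l) + c \<and>
          (l dvd n \<and> int n \<ge> N \<longrightarrow> card F \<le> 2 ^ (n div l))))"
proof -
  define k where "k = core_degree l + 8 * l"
  \<comment> \<open>\<open>C\<close> depends only on \<open>l\<close> and \<open>k\<close>, which
    makes the additive constant and the threshold uniform in \<open>n\<close>.\<close>
  obtain C where C: "\<And>n. n \<ge> C \<Longrightarrow> real n * (real (8 * l) * 2 powr (real (n + k) / real (8 * l)))
      + 2 powr (real (5 * n) / real (8 * l)) \<le> 2 ^ (n div l) / 2"
    using sparse_bound_eventually[OF assms, of k] by blast
  have bound: "real (card F) \<le> 2 ^ (n div l) + real (k * 2 ^ C) \<and>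
      (l dvd n \<and> int n \<ge> int (l * (k * 2 ^ C) + C) \<longrightarrow> card F \<le> 2 ^ (n div l))"
    if F: "F \<subseteq> Pow {1..n}" and kw: "\<forall>G. G \<subseteq> F \<and> card G = k \<longrightarrow> l dvd card (\<Inter>G)"
    for n and F :: "nat set set"
  proof -
    have b: "card F \<le> 2 ^ (n div l) + k * 2 ^ C \<and>
      (l dvd n \<and> n \<ge> l * (k * 2 ^ C) + C \<longrightarrow> card F \<le> 2 ^ (n div l))"
      using k_wise_bound[OF assms k_def C _ F] kw by simp
    then have "real (card F) \<le> real (2 ^ (n div l) + k * 2 ^ C)" by (simp only: of_nat_le_iff)
    also have "\<dots> = 2 ^ (n div l) + real (k * 2 ^ C)" by simp
    finally show ?thesis using b by (simp only: of_nat_le_iff) blast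
  qed
  show ?thesis
    by (rule exI[of _ k], rule exI[of _ "real (k * 2 ^ C)"], rule exI[of _ "int (l * (k * 2 ^ C) + C)"])
      (use assms bound in \<open>auto simp: k_def\<close>)
qed

end
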